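(* Let $G$ be a finite group with lower central series $\gamma_1=G$, $\gamma_{i+1}=[G,\gamma_i]$ and upper central series $1=\zeta^0\leq\zeta^1\leq\cdots$. Then the upper central series factors $L^i(\zeta)=\zeta^i/\zeta^{i-1}$ form a graded Lie module $L^*(\zeta)=\bigoplus_{i>0}L^i(\zeta)$ for the graded Lie ring $L_*(\gamma)=\bigoplus_{i>0}L_i(\gamma)$ of the lower central series factors $L_i(\gamma)=\gamma_i/\gamma_{i+1}$. Precisely: for any choice of group isomorphisms $L^i(\zeta)\cong\hom_{\mathbb{Z}}(L^i(\zeta),\mathbb{Q}/\mathbb{Z})$, $i>0$ (such isomorphisms exist but are not canonical), transporting along them the action of $L_*(\gamma)$ on $\bigoplus_{i>0}\hom_{\mathbb{Z}}(L^i(\zeta),\mathbb{Q}/\mathbb{Z})$ given, for $i,j>0$, $x\in\gamma_i$, $f\in\hom_{\mathbb{Z}}(L^j(\zeta),\mathbb{Q}/\mathbb{Z})$, by $$\bar x\cdot f\in\hom_{\mathbb{Z}}(L^{i+j}(\zeta),\mathbb{Q}/\mathbb{Z}),\qquad \bar y\mapsto -f\big(\overline{[x,y]}\big)\quad(y\in\zeta^{i+j}),$$ makes $L^*(\zeta)$ a graded Lie module for $L_*(\gamma)$.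
   Context: Commutators in a group are $[g,h]=g^{-1}h^{-1}gh$, and $[X,Y]=\langle [x,y]:x\in X,y\in Y\rangle$. The upper central series is given by $\zeta^0=1$ and $\zeta^{i+1}/\zeta^i$ is the center of $G/\zeta^i$. Bars denote classes in the relevant quotient groups; in the formula for the action, $\overline{[x,y]}$ is the class of $[x,y]$ in $\zeta^j/\zeta^{j-1}$. $L_*(\gamma)$ is the graded Lie ring with addition induced by group multiplication and Lie product the biadditive extension of $\bar x\circ\bar y=\overline{[x,y]}\in\gamma_{i+j}/\gamma_{i+j+1}$ for $x\in\gamma_i$, $y\in\gamma_j$. A graded Lie module for a graded Lie ring $L=\bigoplus_i L_i$ is a graded abelian group $V=\bigoplus_j V^j$ with a biadditive action satisfying $(a\circ b)\cdot v=a\cdot(b\cdot v)-b\cdot(a\cdot v)$ and $L_i\cdot V^j\subseteq V^{i+j}$. *)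

theory Defs
  imports "HOL-Algebra.FiniteProduct" "HOL-Algebra.Product_Groups"
begin

subsection \<open>Lower and upper central series\<close>

definition comm :: "('a, 'b) monoid_scheme \<Rightarrow> 'a \<Rightarrow> 'a \<Rightarrow> 'a" where
  "comm G g h = inv\<^bsub>G\<^esub> g \<otimes>\<^bsub>G\<^esub> inv\<^bsub>G\<^esub> h \<otimes>\<^bsub>G\<^esub> g \<otimes>\<^bsub>G\<^esub> h"

definition comm_subgroup :: "('a, 'b) monoid_scheme \<Rightarrow> 'a set \<Rightarrow> 'a set \<Rightarrow> 'a set" where
  "comm_subgroup G X Y = generate G {comm G x y | x y. x \<in> X \<and> y \<in> Y}"

text \<open>The lower central series starts at index 1; the value at 0 is a dummy.\<close>

fun lower_central :: "('a, 'b) monoid_scheme \<Rightarrow> nat \<Rightarrow> 'a set" where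
  "lower_central G 0 = carrier G"
| "lower_central G (Suc 0) = carrier G"
| "lower_central G (Suc (Suc i)) = comm_subgroup G (carrier G) (lower_central G (Suc i))"

definition group_center :: "('a, 'b) monoid_scheme \<Rightarrow> 'a set" where
  "group_center G = {z \<in> carrier G. \<forall>g \<in> carrier G. z \<otimes>\<^bsub>G\<^esub> g = g \<otimes>\<^bsub>G\<^esub> z}"

fun upper_central :: "('a, 'b) monoid_scheme \<Rightarrow> nat \<Rightarrow> 'a set" where
  "upper_central G 0 = {\<one>\<^bsub>G\<^esub>}"
| "upper_central G (Suc i) =
     {g \<in> carrier G. upper_central G i #>\<^bsub>G\<^esub> g \<in> group_center (G Mod upper_central G i)}"

definition lower_factor :: "('a, 'b) monoid_scheme \<Rightarrow> nat \<Rightarrow> 'a set monoid" where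
  "lower_factor G i = (G\<lparr>carrier := lower_central G i\<rparr>) Mod lower_central G (i + 1)"

text \<open>Used for \<open>i > 0\<close> only, so that the truncated subtraction is harmless.\<close>

definition upper_factor :: "('a, 'b) monoid_scheme \<Rightarrow> nat \<Rightarrow> 'a set monoid" where
  "upper_factor G i = (G\<lparr>carrier := upper_central G i\<rparr>) Mod upper_central G (i - 1)"

subsection \<open>Graded Lie rings and graded Lie modules\<close>

text \<open>
  Abelian groups are written multiplicatively, as \<open>comm_group\<close>s: a sum in the mathematical
  notation is a \<open>\<otimes>\<close> here, a negative is an \<open>inv\<close>, and zero is \<open>\<one>\<close>. A graded abelian group is given
  by its components in the positive degrees, and the group itself is their direct sum.
\<close>

abbreviation graded_sum :: "(nat \<Rightarrow> 'a monoid) \<Rightarrow> (nat \<Rightarrow> 'a) monoid" where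
  "graded_sum L \<equiv> sum_group {0<..} L"

text \<open>The copy of the component of degree \<open>i\<close> inside the direct sum.\<close>

definition homogeneous :: "(nat \<Rightarrow> 'a monoid) \<Rightarrow> nat \<Rightarrow> (nat \<Rightarrow> 'a) set" where
  "homogeneous L i = {u \<in> carrier (graded_sum L). \<forall>k>0. k \<noteq> i \<longrightarrow> u k = \<one>\<^bsub>L k\<^esub>}"

definition biadditive ::
  "('a, 'm) monoid_scheme \<Rightarrow> ('b, 'n) monoid_scheme \<Rightarrow> ('c, 'k) monoid_scheme \<Rightarrow> ('a \<Rightarrow> 'b \<Rightarrow> 'c) \<Rightarrow> bool" where
  "biadditive A B C f \<longleftrightarrow>
     (\<forall>a \<in> carrier A. \<forall>b \<in> carrier B. f a b \<in> carrier C) \<and>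
     (\<forall>a \<in> carrier A. \<forall>a' \<in> carrier A. \<forall>b \<in> carrier B. f (a \<otimes>\<^bsub>A\<^esub> a') b = f a b \<otimes>\<^bsub>C\<^esub> f a' b) \<and>
     (\<forall>a \<in> carrier A. \<forall>b \<in> carrier B. \<forall>b' \<in> carrier B. f a (b \<otimes>\<^bsub>B\<^esub> b') = f a b \<otimes>\<^bsub>C\<^esub> f a b')"

locale graded_lie_ring =
  fixes L :: "nat \<Rightarrow> 'a monoid"
    and br :: "(nat \<Rightarrow> 'a) \<Rightarrow> (nat \<Rightarrow> 'a) \<Rightarrow> (nat \<Rightarrow> 'a)"
  assumes comm_group_L: "\<And>i. 0 < i \<Longrightarrow> comm_group (L i)"
    and br_biadditive: "biadditive (graded_sum L) (graded_sum L) (graded_sum L) br"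
    and br_alternating: "\<And>a. a \<in> carrier (graded_sum L) \<Longrightarrow> br a a = \<one>\<^bsub>graded_sum L\<^esub>"
    and jacobi: "\<And>a b c. \<lbrakk>a \<in> carrier (graded_sum L); b \<in> carrier (graded_sum L);
        c \<in> carrier (graded_sum L)\<rbrakk> \<Longrightarrow>
        br a (br b c) \<otimes>\<^bsub>graded_sum L\<^esub> br b (br c a) \<otimes>\<^bsub>graded_sum L\<^esub> br c (br a b) = \<one>\<^bsub>graded_sum L\<^esub>"
    and br_graded: "\<And>i j a b. \<lbrakk>0 < i; 0 < j; a \<in> homogeneous L i; b \<in> homogeneous L j\<rbrakk> \<Longrightarrow>
        br a b \<in> homogeneous L (i + j)"

locale graded_lie_module = graded_lie_ring L br
  for L :: "nat \<Rightarrow> 'a monoid"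
    and br :: "(nat \<Rightarrow> 'a) \<Rightarrow> (nat \<Rightarrow> 'a) \<Rightarrow> (nat \<Rightarrow> 'a)" +
  fixes V :: "nat \<Rightarrow> 'v monoid"
    and act :: "(nat \<Rightarrow> 'a) \<Rightarrow> (nat \<Rightarrow> 'v) \<Rightarrow> (nat \<Rightarrow> 'v)"
  assumes comm_group_V: "\<And>j. 0 < j \<Longrightarrow> comm_group (V j)"
    and act_biadditive: "biadditive (graded_sum L) (graded_sum V) (graded_sum V) act"
    and act_bracket: "\<And>a b v. \<lbrakk>a \<in> carrier (graded_sum L); b \<in> carrier (graded_sum L);
        v \<in> carrier (graded_sum V)\<rbrakk> \<Longrightarrow>
        act (br a b) v = act a (act b v) \<otimes>\<^bsub>graded_sum V\<^esub> inv\<^bsub>graded_sum V\<^esub> (act b (act a v))"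
    and act_graded: "\<And>i j a v. \<lbrakk>0 < i; 0 < j; a \<in> homogeneous L i; v \<in> homogeneous V j\<rbrakk> \<Longrightarrow>
        act a v \<in> homogeneous V (i + j)"

text \<open>
  The biadditive extension to the direct sums of a family \<open>m i j\<close> of products of a component of
  degree \<open>i\<close> with a component of degree \<open>j\<close>, valued in the component \<open>V (i + j)\<close>.
\<close>

definition graded_extension ::
  "(nat \<Rightarrow> 'v monoid) \<Rightarrow> (nat \<Rightarrow> nat \<Rightarrow> 'a \<Rightarrow> 'b \<Rightarrow> 'v) \<Rightarrow> (nat \<Rightarrow> 'a) \<Rightarrow> (nat \<Rightarrow> 'b) \<Rightarrow> (nat \<Rightarrow> 'v)" where
  "graded_extension V m u v =
     (\<lambda>k\<in>{0<..}. finprod (V k) (\<lambda>i. m i (k - i) (u i) (v (k - i))) {0<..<k})"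

subsection \<open>The Lie ring of the lower central series\<close>

text \<open>
  Operations on cosets are defined as the union of the cosets obtained from all choices of
  representatives. This is a single coset exactly if the choice does not matter.
\<close>

definition lower_bracket ::
  "('a, 'b) monoid_scheme \<Rightarrow> nat \<Rightarrow> nat \<Rightarrow> 'a set \<Rightarrow> 'a set \<Rightarrow> 'a set" where
  "lower_bracket G i j X Y = (\<Union>x\<in>X. \<Union>y\<in>Y. lower_central G (i + j + 1) #>\<^bsub>G\<^esub> comm G x y)"

definition lower_lie ::
  "('a, 'b) monoid_scheme \<Rightarrow> (nat \<Rightarrow> 'a set) \<Rightarrow> (nat \<Rightarrow> 'a set) \<Rightarrow> (nat \<Rightarrow> 'a set)" where
  "lower_lie G = graded_extension (lower_factor G) (lower_bracket G)"

subsection \<open>The action on the duals of the upper central series factors\<close>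

definition rat_mod_int :: "rat set monoid" where
  "rat_mod_int = \<lparr>carrier = UNIV, mult = (+), one = 0\<rparr> Mod \<int>"

text \<open>
  The group of homomorphisms into the rationals modulo the integers; homomorphisms are
  represented by functions that are extensional on the carrier.
\<close>

definition dual_group :: "('a, 'b) monoid_scheme \<Rightarrow> ('a \<Rightarrow> rat set) monoid" where
  "dual_group A =
     \<lparr>carrier = hom A rat_mod_int \<inter> extensional (carrier A),
      mult = (\<lambda>f g. \<lambda>a\<in>carrier A. f a \<otimes>\<^bsub>rat_mod_int\<^esub> g a),
      one = (\<lambda>a\<in>carrier A. \<one>\<^bsub>rat_mod_int\<^esub>)\<rparr>"

abbreviation upper_dual :: "('a, 'b) monoid_scheme \<Rightarrow> nat \<Rightarrow> ('a set \<Rightarrow> rat set) monoid" where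
  "upper_dual G i \<equiv> dual_group (upper_factor G i)"

text \<open>The class of \<open>[x, y]\<close> in degree \<open>j\<close>, for \<open>X\<close> the class of \<open>x\<close> and \<open>Y\<close> the class of \<open>y\<close>.\<close>

definition upper_bracket :: "('a, 'b) monoid_scheme \<Rightarrow> nat \<Rightarrow> 'a set \<Rightarrow> 'a set \<Rightarrow> 'a set" where
  "upper_bracket G j X Y = (\<Union>x\<in>X. \<Union>y\<in>Y. upper_central G (j - 1) #>\<^bsub>G\<^esub> comm G x y)"

definition dual_action ::
  "('a, 'b) monoid_scheme \<Rightarrow> nat \<Rightarrow> nat \<Rightarrow> 'a set \<Rightarrow> ('a set \<Rightarrow> rat set) \<Rightarrow> ('a set \<Rightarrow> rat set)" where
  "dual_action G i j X f =
     (\<lambda>Y\<in>carrier (upper_factor G (i + j)). inv\<^bsub>rat_mod_int\<^esub> (f (upper_bracket G j X Y)))"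

definition dual_lie_action ::
  "('a, 'b) monoid_scheme \<Rightarrow> (nat \<Rightarrow> 'a set) \<Rightarrow> (nat \<Rightarrow> 'a set \<Rightarrow> rat set) \<Rightarrow> (nat \<Rightarrow> 'a set \<Rightarrow> rat set)" where
  "dual_lie_action G = graded_extension (upper_dual G) (dual_action G)"

definition transported_action ::
  "('a, 'b) monoid_scheme \<Rightarrow> (nat \<Rightarrow> 'a set \<Rightarrow> 'a set \<Rightarrow> rat set) \<Rightarrow>
     nat \<Rightarrow> nat \<Rightarrow> 'a set \<Rightarrow> 'a set \<Rightarrow> 'a set" where
  "transported_action G \<phi> i j X v =
     inv_into (carrier (upper_factor G (i + j))) (\<phi> (i + j)) (dual_action G i j X (\<phi> j v))"

definition transported_lie_action ::
  "('a, 'b) monoid_scheme \<Rightarrow> (nat \<Rightarrow> 'a set \<Rightarrow> 'a set \<Rightarrow> rat set) \<Rightarrow>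
     (nat \<Rightarrow> 'a set) \<Rightarrow> (nat \<Rightarrow> 'a set) \<Rightarrow> (nat \<Rightarrow> 'a set)" where
  "transported_lie_action G \<phi> = graded_extension (upper_factor G) (transported_action G \<phi>)"

end

theory Submission
  imports Defs "HOL-Algebra.Multiplicative_Group"
begin

text \<open>
  Commutation with \<open>\<gamma>\<^sub>i\<close> moves up by \<open>i\<close> steps in the lower central series and down by \<open>i\<close> steps in the
  upper one. Both are cases of a descending chain of normal subgroups \<open>M\<^sub>k\<close> with \<open>[G, M\<^sub>k] \<subseteq> M\<^sub>k\<^sub>+\<^sub>1\<close>
  (\<open>central_filtration\<close>): either \<open>M\<^sub>k = \<gamma>\<^sub>k\<close>, or \<open>M\<^sub>k = \<zeta>\<^sup>n\<^sup>-\<^sup>k\<close> for a fixed \<open>n\<close>. The Hall--Witt identity yields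
  \<open>[\<gamma>\<^sub>i, M\<^sub>k] \<subseteq> M\<^sub>i\<^sub>+\<^sub>k\<close> (\<open>comm_lower_central_M\<close>). As \<open>M\<^sub>i\<^sub>+\<^sub>k\<close> is central modulo \<open>M\<^sub>i\<^sub>+\<^sub>k\<^sub>+\<^sub>1\<close>, commutators induce
  biadditive brackets of \<open>\<gamma>\<^sub>i/\<gamma>\<^sub>i\<^sub>+\<^sub>1\<close> with \<open>M\<^sub>k/M\<^sub>k\<^sub>+\<^sub>1\<close>, and the Hall--Witt identity becomes
  \<open>[[x, y], z] = [x, [y, z]] - [y, [x, z]]\<close> (\<open>jacobi_mod\<close>).

  For the lower central series this is the Jacobi identity of \<open>L\<^sub>*(\<gamma>)\<close>. For the upper central series it
  says that \<open>L\<^sub>*(\<gamma>)\<close> acts on the factors \<open>\<zeta>\<^sup>j/\<zeta>\<^sup>j\<^sup>-\<^sup>1\<close> with lowering of degrees; the action on the duals,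
  which is the contragredient one, then raises degrees as required (\<open>dual_derivation_pairing\<close>). All
  identities are proved on homogeneous components. They extend to the direct sums because both sides
  are additive in each variable (\<open>act_bracket\<close>).

  It remains to return from the duals to the factors. A module structure can be transported along
  isomorphisms in each degree (\<open>graded_derivation_pairing_transport\<close>), and such isomorphisms exist
  because a finite abelian group is isomorphic to its dual (\<open>iso_dual_group\<close>): a character with the
  largest possible image splits off a cyclic direct factor, which is isomorphic to its own dual, and
  its kernel is handled by induction.
\<close>

section \<open>Commutator calculus\<close>

context group
begin

lemma cancel_left:
  assumes "x \<in> carrier G" "y \<in> carrier G"
  shows "x \<otimes> (inv x \<otimes> y) = y" "inv x \<otimes> (x \<otimes> y) = y"
  using assms by (simp_all flip: m_assoc)

lemmas word_simps = comm_def m_assoc inv_mult_group cancel_left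

lemma comm_closed [simp, intro]:
  "x \<in> carrier G \<Longrightarrow> y \<in> carrier G \<Longrightarrow> comm G x y \<in> carrier G"
  by (simp add: comm_def)

lemma inv_commutator: "x \<in> carrier G \<Longrightarrow> y \<in> carrier G \<Longrightarrow> inv (comm G x y) = comm G y x"
  by (simp add: word_simps)

lemma comm_self: "x \<in> carrier G \<Longrightarrow> comm G x x = \<one>"
  by (simp add: word_simps)

lemma mult_comm: "x \<in> carrier G \<Longrightarrow> y \<in> carrier G \<Longrightarrow> x \<otimes> y = y \<otimes> (x \<otimes> comm G x y)"
  by (simp add: word_simps)

lemma conj_comm:
  assumes "g \<in> carrier G" "x \<in> carrier G" "y \<in> carrier G"
  shows "g \<otimes> comm G x y \<otimes> inv g = comm G (g \<otimes> x \<otimes> inv g) (g \<otimes> y \<otimes> inv g)"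
  using assms by (simp add: word_simps)

lemma comm_mult_left:
  assumes "x \<in> carrier G" "x' \<in> carrier G" "y \<in> carrier G"
  shows "comm G (x \<otimes> x') y = inv x' \<otimes> comm G x y \<otimes> x' \<otimes> comm G x' y"
  using assms by (simp add: word_simps)

lemma comm_mult_right:
  assumes "x \<in> carrier G" "y \<in> carrier G" "y' \<in> carrier G"
  shows "comm G x (y \<otimes> y') = comm G x y' \<otimes> (inv y' \<otimes> comm G x y \<otimes> y')"
  using assms by (simp add: word_simps)

lemma comm_inv_left:
  assumes "x \<in> carrier G" "y \<in> carrier G"
  shows "comm G (inv x) y = inv (inv x) \<otimes> inv (comm G x y) \<otimes> inv x"
  using assms by (simp add: word_simps)

lemma comm_inv_right:
  assumes "x \<in> carrier G" "y \<in> carrier G"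
  shows "comm G x (inv y) = inv (inv y) \<otimes> inv (comm G x y) \<otimes> inv y"
  using assms by (simp add: word_simps)

lemma Hall_Witt:
  assumes "x \<in> carrier G" "y \<in> carrier G" "z \<in> carrier G"
  shows "(inv y \<otimes> comm G (comm G x (inv y)) z \<otimes> y)
       \<otimes> (inv z \<otimes> comm G (comm G y (inv z)) x \<otimes> z)
       \<otimes> (inv x \<otimes> comm G (comm G z (inv x)) y \<otimes> x) = \<one>"
  using assms by (simp add: word_simps)

lemma r_coset_mult:
  assumes "N \<lhd> G" "a \<in> carrier G" "b \<in> carrier G"
  shows "N #> (a \<otimes> b) = (N #> a) <#> (N #> b)"
  using assms by (simp add: normal.rcos_sum)

text \<open>
  Congruence modulo a normal subgroup \<open>N\<close> is expressed as equality of cosets \<open>N #> a = N #> b\<close>, because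
  elements of quotient groups are cosets and the operations on them can be used for rewriting.
\<close>

lemma r_coset_absorb:
  assumes "N \<lhd> G" "a \<in> carrier G" "n \<in> N"
  shows "N #> (n \<otimes> a) = N #> a" "N #> (a \<otimes> n) = N #> a"
proof -
  interpret normal N G by fact
  have n: "N #> n = N" using assms coset_join2 subgroup_axioms by auto
  have "N #> (n \<otimes> a) = N <#> (N #> a)" "N #> (a \<otimes> n) = (N #> a) <#> N"
    using assms n by (simp_all flip: rcos_sum)
  moreover have "N <#> (N #> a) = N #> a" "(N #> a) <#> N = N #> a"
    using rcos_sum[of \<one> a] rcos_sum[of a \<one>] assms subset by simp_all
  ultimately show "N #> (n \<otimes> a) = N #> a" "N #> (a \<otimes> n) = N #> a" by simp_all
qed

lemma r_coset_eq_mem_iff: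
  assumes "N \<lhd> G" "a \<in> carrier G"
  shows "N #> a = N \<longleftrightarrow> a \<in> N"
  using assms coset_join1 coset_join2 normal_imp_subgroup subgroup.subset by metis

lemma r_coset_inv_cong:
  assumes "N \<lhd> G" "a \<in> carrier G" "b \<in> carrier G" "N #> a = N #> b"
  shows "N #> inv a = N #> inv b"
  using assms by (metis normal.rcos_inv)

lemma r_coset_eqE:
  assumes "N \<lhd> G" "a \<in> carrier G" "b \<in> carrier G" "N #> a = N #> b"
  obtains n where "n \<in> N" "a = n \<otimes> b"
proof -
  have "a \<in> N #> b" using assms rcos_self normal_imp_subgroup by blast
  then show ?thesis using that by (auto simp: r_coset_def)
qed

lemma comm_mem_normal:
  assumes "N \<lhd> G" "n \<in> N" "g \<in> carrier G"
  shows "comm G n g \<in> N" "comm G g n \<in> N"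
proof -
  interpret normal N G by fact
  have "comm G n g = inv n \<otimes> (inv g \<otimes> n \<otimes> g)" "comm G g n = (inv g \<otimes> inv n \<otimes> g) \<otimes> n"
    using assms by (simp_all add: comm_def m_assoc)
  then show "comm G n g \<in> N" "comm G g n \<in> N"
    using assms inv_op_closed1 by simp_all
qed

lemma comm_mem_swap:
  assumes "N \<lhd> G" "x \<in> carrier G" "y \<in> carrier G" "comm G x y \<in> N"
  shows "comm G y x \<in> N"
  using subgroup.m_inv_closed[OF normal_imp_subgroup[OF assms(1)] assms(4)] assms by (simp add: inv_commutator)

lemma r_coset_commute:
  assumes "N \<lhd> G" "x \<in> carrier G" "y \<in> carrier G" "comm G x y \<in> N"
  shows "N #> (x \<otimes> y) = N #> (y \<otimes> x)"
proof -
  have "N #> (x \<otimes> y) = (N #> y) <#> (N #> (x \<otimes> comm G x y))"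
    using assms by (subst mult_comm) (simp_all add: r_coset_mult)
  also have "\<dots> = N #> (y \<otimes> x)" using assms by (simp add: r_coset_absorb r_coset_mult)
  finally show ?thesis .
qed

lemma r_coset_conj:
  assumes "N \<lhd> G" "x \<in> carrier G" "y \<in> carrier G" "comm G x y \<in> N"
  shows "N #> (inv y \<otimes> x \<otimes> y) = N #> x"
proof -
  have "inv y \<otimes> x \<otimes> y = x \<otimes> comm G x y" using assms by (simp add: word_simps)
  then show ?thesis using assms r_coset_absorb by simp
qed

text \<open>
  A commutator subgroup is given by generators. Since the elements centralizing \<open>Y\<close> modulo a normal
  subgroup form a subgroup, a commutator condition on it need only be tested on these generators.
\<close>

lemma centralizer_mod_subgroup:
  assumes "N \<lhd> G" "Y \<subseteq> carrier G"
  shows "subgroup {g \<in> carrier G. \<forall>y\<in>Y. comm G g y \<in> N} G"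
proof -
  interpret normal N G by fact
  show ?thesis
  proof (rule subgroupI)
    show "{g \<in> carrier G. \<forall>y\<in>Y. comm G g y \<in> N} \<noteq> {}"
      using assms by (auto simp: comm_def intro!: exI[of _ \<one>] dest: subsetD)
  next
    fix a assume "a \<in> {g \<in> carrier G. \<forall>y\<in>Y. comm G g y \<in> N}"
    then show "inv a \<in> {g \<in> carrier G. \<forall>y\<in>Y. comm G g y \<in> N}"
      using assms inv_op_closed2 by (auto simp: comm_inv_left subset_iff)
  next
    fix a b assume "a \<in> {g \<in> carrier G. \<forall>y\<in>Y. comm G g y \<in> N}"
      "b \<in> {g \<in> carrier G. \<forall>y\<in>Y. comm G g y \<in> N}"
    then show "a \<otimes> b \<in> {g \<in> carrier G. \<forall>y\<in>Y. comm G g y \<in> N}"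
      using assms inv_op_closed1 by (auto simp: comm_mult_left subset_iff)
  qed auto
qed

text \<open>
  The elementwise form of the three subgroups lemma: in the Hall--Witt identity the factors are
  conjugates of the three double commutators, so if two of these lie in \<open>N\<close> then so does the third.
\<close>

lemma three_subgroups_mem:
  assumes N: "N \<lhd> G" and xyz: "x \<in> carrier G" "y \<in> carrier G" "z \<in> carrier G"
    and "comm G (comm G y (inv z)) x \<in> N" "comm G (comm G z (inv x)) y \<in> N"
  shows "comm G (comm G x (inv y)) z \<in> N"
proof -
  interpret normal N G by fact
  define u where "u = inv y \<otimes> comm G (comm G x (inv y)) z \<otimes> y"
  define n where "n = (inv z \<otimes> comm G (comm G y (inv z)) x \<otimes> z)
       \<otimes> (inv x \<otimes> comm G (comm G z (inv x)) y \<otimes> x)"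
  have c: "u \<in> carrier G" and n: "n \<in> N"
    using assms inv_op_closed1 by (auto simp: u_def n_def)
  have "u \<otimes> n = \<one>"
    unfolding u_def n_def using Hall_Witt[OF xyz] xyz by (simp add: m_assoc)
  then have "u = inv n" using c n inv_equality[of u n] by simp
  then have "y \<otimes> u \<otimes> inv y \<in> N" using n xyz inv_op_closed2 by simp
  moreover have "y \<otimes> u \<otimes> inv y = comm G (comm G x (inv y)) z"
    using xyz by (simp add: u_def m_assoc cancel_left)
  ultimately show ?thesis by simp
qed

section \<open>Lower and upper central series\<close>

lemma comm_subgroup_normal:
  assumes "N \<lhd> G"
  shows "comm_subgroup G (carrier G) N \<lhd> G"
  unfolding comm_subgroup_def
proof (rule normal_generateI)
  interpret normal N G by fact
  show "{comm G x y |x y. x \<in> carrier G \<and> y \<in> N} \<subseteq> carrier G" by auto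
  fix h g assume "h \<in> {comm G x y |x y. x \<in> carrier G \<and> y \<in> N}" and g: "g \<in> carrier G"
  then obtain x y where xy: "x \<in> carrier G" "y \<in> N" and h: "h = comm G x y" by blast
  have "g \<otimes> h \<otimes> inv g = comm G (g \<otimes> x \<otimes> inv g) (g \<otimes> y \<otimes> inv g)"
    using g xy unfolding h by (intro conj_comm) auto
  moreover have "g \<otimes> x \<otimes> inv g \<in> carrier G" "g \<otimes> y \<otimes> inv g \<in> N"
    using g xy inv_op_closed2 by simp_all
  ultimately show "g \<otimes> h \<otimes> inv g \<in> {comm G x y |x y. x \<in> carrier G \<and> y \<in> N}" by blast
qed

lemma lower_central_normal: "lower_central G i \<lhd> G"
proof (induction i)
  case (Suc i)
  then show ?case using normal_self comm_subgroup_normal by (cases i) auto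
qed (simp add: normal_self)

lemma comm_lower_central:
  assumes "x \<in> carrier G" "y \<in> lower_central G i"
  shows "comm G x y \<in> lower_central G (Suc i)"
proof (cases i)
  case (Suc k)
  then show ?thesis using assms by (auto simp: comm_subgroup_def intro!: generate.incl)
next
  case 0
  then show ?thesis using assms by simp
qed

lemma lower_central_antimono: "lower_central G (Suc i) \<subseteq> lower_central G i"
proof (cases i)
  case (Suc k)
  let ?N = "lower_central G (Suc k)"
  have "comm_subgroup G (carrier G) ?N \<subseteq> ?N"
    unfolding comm_subgroup_def using comm_mem_normal[OF lower_central_normal]
      normal_imp_subgroup[OF lower_central_normal]
    by (intro generate_subgroup_incl) blast+
  then show ?thesis using Suc by simp
qed auto

lemma upper_central_Suc_iff:
  assumes "upper_central G i \<lhd> G"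
  shows "g \<in> upper_central G (Suc i) \<longleftrightarrow>
     g \<in> carrier G \<and> (\<forall>x\<in>carrier G. comm G g x \<in> upper_central G i)"
proof -
  let ?N = "upper_central G i"
  interpret normal ?N G by fact
  have "?N #> (g \<otimes> x) = ?N #> (x \<otimes> g) \<longleftrightarrow> comm G g x \<in> ?N"
    if "g \<in> carrier G" "x \<in> carrier G" for x
  proof
    assume eq: "?N #> (g \<otimes> x) = ?N #> (x \<otimes> g)"
    have "comm G g x = inv (x \<otimes> g) \<otimes> (g \<otimes> x)" using that by (simp add: word_simps)
    then have "?N #> comm G g x = ?N #> \<one>"
      using that eq by (simp add: r_coset_mult[OF assms] del: inv_mult_group)
         (simp add: rcos_sum)
    then show "comm G g x \<in> ?N" using r_coset_eq_mem_iff[OF assms] that subset by simp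
  qed (use that r_coset_commute[OF assms] in blast)
  then show ?thesis
    by (auto simp: group_center_def carrier_FactGroup r_coset_mult[OF assms, symmetric])
qed

lemma upper_central_normal: "upper_central G i \<lhd> G"
proof (induction i)
  case 0
  then show ?case using one_is_normal by simp
next
  case (Suc i)
  let ?N = "upper_central G i"
  interpret normal ?N G by fact
  have eq: "upper_central G (Suc i) = {g \<in> carrier G. \<forall>x\<in>carrier G. comm G g x \<in> ?N}"
    using upper_central_Suc_iff[OF Suc.IH] by blast
  have "g \<otimes> h \<otimes> inv g \<in> upper_central G (Suc i)"
    if "h \<in> upper_central G (Suc i)" "g \<in> carrier G" for h g
    unfolding eq
  proof (intro CollectI conjI ballI)
    fix x assume x: "x \<in> carrier G"
    have h: "h \<in> carrier G" "comm G h (inv g \<otimes> x \<otimes> g) \<in> ?N" using that x unfolding eq by auto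
    have "comm G (g \<otimes> h \<otimes> inv g) x = g \<otimes> comm G h (inv g \<otimes> x \<otimes> g) \<otimes> inv g"
      using that x h by (simp add: word_simps)
    then show "comm G (g \<otimes> h \<otimes> inv g) x \<in> ?N" using h that inv_op_closed2 by simp
  qed (use that eq in auto)
  then show ?case
    using centralizer_mod_subgroup[OF Suc.IH subset_refl] eq by (simp add: normal_inv_iff del: upper_central.simps)
qed

lemma comm_upper_central:
  assumes "x \<in> carrier G" "y \<in> upper_central G i"
  shows "comm G x y \<in> upper_central G (i - 1)"
proof (cases i)
  case 0
  then show ?thesis using assms by (simp add: comm_def)
next
  case (Suc k)
  then show ?thesis
    using assms upper_central_Suc_iff[OF upper_central_normal] comm_mem_swap[OF upper_central_normal] by auto
qed

lemma upper_central_mono: "upper_central G (i - 1) \<subseteq> upper_central G i"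
proof (cases i)
  case (Suc k)
  have "upper_central G k \<subseteq> upper_central G (Suc k)"
    using upper_central_Suc_iff[OF upper_central_normal, of _ k] comm_mem_normal[OF upper_central_normal]
      subgroup.subset[OF normal_imp_subgroup[OF upper_central_normal]] by blast
  then show ?thesis using Suc by simp
qed auto

end

section \<open>Brackets along a central filtration\<close>

text \<open>
  Commutators with terms of either central series are studied through this common notion. The index of
  the upper central series is reversed, because commutation with \<open>G\<close> lowers it: for each \<open>n\<close> the chain
  \<open>M k = upper_central G (n - k)\<close> is descending, and it becomes constantly trivial from \<open>k = n\<close> on.
\<close>

locale central_filtration = group G for G (structure) +
  fixes M :: "nat \<Rightarrow> 'a set"
  assumes M_normal: "M k \<lhd> G"
    and M_antimono: "M (Suc k) \<subseteq> M k"
    and comm_M_Suc: "\<lbrakk>g \<in> carrier G; y \<in> M k\<rbrakk> \<Longrightarrow> comm G g y \<in> M (Suc k)"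

lemma (in group) lower_central_filtration: "central_filtration G (lower_central G)"
  by (intro central_filtration.intro central_filtration_axioms.intro is_group)
     (simp_all add: lower_central_normal lower_central_antimono comm_lower_central del: lower_central.simps)

lemma (in group) upper_central_filtration: "central_filtration G (\<lambda>k. upper_central G (n - k))"
proof (intro central_filtration.intro central_filtration_axioms.intro is_group)
  fix k
  show "upper_central G (n - k) \<lhd> G" by (rule upper_central_normal)
  show "upper_central G (n - Suc k) \<subseteq> upper_central G (n - k)"
    using upper_central_mono[of "n - k"] by simp
  fix g y assume "g \<in> carrier G" "y \<in> upper_central G (n - k)"
  then show "comm G g y \<in> upper_central G (n - Suc k)"
    using comm_upper_central[of g y "n - k"] by simp
qed

lemma (in group) lower_central_in_carrier [dest]: "x \<in> lower_central G i \<Longrightarrow> x \<in> carrier G"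
  using subgroup.subset[OF normal_imp_subgroup[OF lower_central_normal]] by blast

lemma (in group) upper_central_in_carrier [dest]: "x \<in> upper_central G i \<Longrightarrow> x \<in> carrier G"
  using subgroup.subset[OF normal_imp_subgroup[OF upper_central_normal]] by blast

context central_filtration
begin

lemma M_in_carrier [dest, simp]: "x \<in> M k \<Longrightarrow> x \<in> carrier G"
  using subgroup.subset[OF normal_imp_subgroup[OF M_normal]] by blast

lemma M_inv: "x \<in> M k \<Longrightarrow> inv x \<in> M k"
  using subgroup.m_inv_closed[OF normal_imp_subgroup[OF M_normal]] by blast

lemma lower_central_inv: "x \<in> lower_central G k \<Longrightarrow> inv x \<in> lower_central G k"
  using subgroup.m_inv_closed[OF normal_imp_subgroup[OF lower_central_normal]] by blast

lemma comm_M_Suc': "\<lbrakk>g \<in> carrier G; y \<in> M k\<rbrakk> \<Longrightarrow> comm G y g \<in> M (Suc k)"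
  by (rule comm_mem_swap[OF M_normal]) (simp_all add: comm_M_Suc)

text \<open>
  In step \<open>i\<close> a generator of \<open>\<gamma>\<^sub>i\<^sub>+\<^sub>1\<close> is \<open>[a, b]\<close> with \<open>b \<in> \<gamma>\<^sub>i\<close>. Of the two other double commutators in the
  Hall--Witt identity for \<open>a\<close>, \<open>b\<inverse>\<close> and \<open>z \<in> M\<^sub>k\<close>, one is covered by the induction hypothesis for \<open>M\<^sub>k\<close>,
  followed by a commutator with \<open>a\<close>; the other by the induction hypothesis for \<open>M\<^sub>k\<^sub>+\<^sub>1\<close>, which contains
  \<open>[z, a\<inverse>]\<close>.
\<close>

lemma comm_lower_central_M:
  assumes "0 < i" "x \<in> lower_central G i" "y \<in> M k"
  shows "comm G x y \<in> M (i + k)"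
  using assms
proof (induction i arbitrary: x y k rule: nat_induct_non_zero)
  case 1
  then show ?case by (simp add: comm_M_Suc)
next
  case (Suc i)
  obtain i' where i: "i = Suc i'" using Suc.hyps gr0_implies_Suc by blast
  let ?C = "{g \<in> carrier G. \<forall>z\<in>M k. comm G g z \<in> M (Suc i + k)}"
  have "comm G a b \<in> ?C" if a: "a \<in> carrier G" and b: "b \<in> lower_central G i" for a b
  proof (intro CollectI conjI ballI)
    fix z assume z: "z \<in> M k"
    have [simp]: "b \<in> carrier G" using b by blast
    have b': "inv b \<in> lower_central G i" using b by (rule lower_central_inv)
    have "comm G (inv b) (inv z) \<in> M (i + k)"
      using b' z M_inv Suc.IH by blast
    then have 1: "comm G (comm G (inv b) (inv z)) a \<in> M (Suc i + k)"
      using a comm_M_Suc' by simp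
    have "comm G z (inv a) \<in> M (Suc k)" using a z comm_M_Suc' by simp
    then have "comm G (inv b) (comm G z (inv a)) \<in> M (i + Suc k)"
      using b' Suc.IH by blast
    then have 2: "comm G (comm G z (inv a)) (inv b) \<in> M (Suc i + k)"
      using a b z comm_mem_swap[OF M_normal] by simp
    have "comm G (comm G a (inv (inv b))) z \<in> M (Suc i + k)"
      using a z 1 2 three_subgroups_mem[OF M_normal, of a "inv b" z "Suc i + k"] by simp
    then show "comm G (comm G a b) z \<in> M (Suc i + k)" using b by simp
  qed (use a b in auto)
  then have "{comm G a b |a b. a \<in> carrier G \<and> b \<in> lower_central G i} \<subseteq> ?C" by blast
  then have "generate G {comm G a b |a b. a \<in> carrier G \<and> b \<in> lower_central G i} \<subseteq> ?C"
    by (rule generate_subgroup_incl) (rule centralizer_mod_subgroup, auto simp: M_normal)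
  then have "lower_central G (Suc i) \<subseteq> ?C"
    unfolding i lower_central.simps comm_subgroup_def .
  then show ?case using Suc.prems by blast
qed

text \<open>
  Commutators of \<open>\<gamma>\<^sub>i\<close> with \<open>M\<^sub>k\<close> lie in \<open>M\<^sub>i\<^sub>+\<^sub>k\<close>, which is central modulo \<open>M\<^sub>i\<^sub>+\<^sub>k\<^sub>+\<^sub>1\<close>. The conjugations in the
  commutator identities therefore disappear modulo \<open>M\<^sub>i\<^sub>+\<^sub>k\<^sub>+\<^sub>1\<close>, which makes the commutator biadditive.
\<close>

context
  fixes i k x y
  assumes i: "0 < i" and x: "x \<in> lower_central G i" and y: "y \<in> M k"
begin

lemma xy_carrier [simp]: "x \<in> carrier G" "y \<in> carrier G"
  using x y by auto

lemma central_mod: "g \<in> carrier G \<Longrightarrow> comm G (comm G x y) g \<in> M (Suc (i + k))"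
  using i x y comm_lower_central_M comm_M_Suc' by blast

lemma comm_mult_left_mod:
  assumes x': "x' \<in> lower_central G i"
  shows "M (Suc (i + k)) #> comm G (x \<otimes> x') y = M (Suc (i + k)) #> (comm G x y \<otimes> comm G x' y)"
proof -
  let ?N = "M (Suc (i + k))"
  have [simp]: "x' \<in> carrier G" using x' by blast
  have "?N #> comm G (x \<otimes> x') y = (?N #> (inv x' \<otimes> comm G x y \<otimes> x')) <#> (?N #> comm G x' y)"
    by (simp add: comm_mult_left flip: r_coset_mult[OF M_normal])
  then show ?thesis
    by (simp add: r_coset_conj[OF M_normal] central_mod) (simp add: r_coset_mult[OF M_normal])
qed

lemma comm_mult_right_mod:
  assumes "y' \<in> M k"
  shows "M (Suc (i + k)) #> comm G x (y \<otimes> y') = M (Suc (i + k)) #> (comm G x y \<otimes> comm G x y')"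
proof -
  let ?N = "M (Suc (i + k))"
  have [simp]: "y' \<in> carrier G" using assms by blast
  have "?N #> comm G x (y \<otimes> y') = (?N #> comm G x y') <#> (?N #> (inv y' \<otimes> comm G x y \<otimes> y'))"
    by (simp add: comm_mult_right flip: r_coset_mult[OF M_normal])
  also have "\<dots> = ?N #> (comm G x y' \<otimes> comm G x y)"
    by (simp add: r_coset_conj[OF M_normal] central_mod) (simp add: r_coset_mult[OF M_normal])
  also have "\<dots> = ?N #> (comm G x y \<otimes> comm G x y')"
    by (rule r_coset_commute[OF M_normal, symmetric]) (simp_all add: central_mod)
  finally show ?thesis .
qed

lemma central_inv_mod:
  "g \<in> carrier G \<Longrightarrow> comm G (inv (comm G x y)) g \<in> M (Suc (i + k))"
  using comm_M_Suc'[OF _ M_inv[OF comm_lower_central_M[OF i x y]]] by simp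

lemma comm_inv_left_mod: "M (Suc (i + k)) #> comm G (inv x) y = M (Suc (i + k)) #> inv (comm G x y)"
  using r_coset_conj[OF M_normal _ _ central_inv_mod[of "inv x"]] by (simp add: comm_inv_left)

lemma comm_inv_right_mod: "M (Suc (i + k)) #> comm G x (inv y) = M (Suc (i + k)) #> inv (comm G x y)"
  using r_coset_conj[OF M_normal _ _ central_inv_mod[of "inv y"]] by (simp add: comm_inv_right)

lemma comm_cong_left_mod:
  assumes "x' \<in> lower_central G i" "lower_central G (Suc i) #> x' = lower_central G (Suc i) #> x"
  shows "M (Suc (i + k)) #> comm G x' y = M (Suc (i + k)) #> comm G x y"
proof -
  obtain c where c: "c \<in> lower_central G (Suc i)" "x' = c \<otimes> x"
    using assms x r_coset_eqE[OF lower_central_normal] by blast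
  have "comm G c y \<in> M (Suc (i + k))" using comm_lower_central_M[OF _ c(1) y] by simp
  moreover have "c \<in> lower_central G i" using c lower_central_antimono by blast
  then have "M (Suc (i + k)) #> comm G x' y = M (Suc (i + k)) #> (comm G c y \<otimes> comm G x y)"
    using central_filtration.comm_mult_left_mod[OF central_filtration_axioms i _ y x] c by blast
  ultimately show ?thesis using c by (simp add: r_coset_absorb[OF M_normal])
qed

lemma comm_cong_right_mod:
  assumes "y' \<in> M k" "M (Suc k) #> y' = M (Suc k) #> y"
  shows "M (Suc (i + k)) #> comm G x y' = M (Suc (i + k)) #> comm G x y"
proof -
  obtain d where d: "d \<in> M (Suc k)" "y' = d \<otimes> y"
    using assms y r_coset_eqE[OF M_normal] by blast
  have "comm G x d \<in> M (Suc (i + k))" using comm_lower_central_M[OF i x d(1)] by simp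
  moreover have "d \<in> M k" using d M_antimono by blast
  then have "M (Suc (i + k)) #> comm G x y' = M (Suc (i + k)) #> (comm G x d \<otimes> comm G x y)"
    using central_filtration.comm_mult_right_mod[OF central_filtration_axioms i x _ y] d by blast
  ultimately show ?thesis using d by (simp add: r_coset_absorb[OF M_normal])
qed

end

text \<open>
  Independence of representatives, in the form in which brackets of cosets are defined.
\<close>

lemma comm_coset_mod:
  assumes "0 < i" "x \<in> lower_central G i" "y \<in> M k"
  shows "(\<Union>x'\<in>lower_central G (Suc i) #> x. \<Union>y'\<in>M (Suc k) #> y. M (Suc (i + k)) #> comm G x' y')
    = M (Suc (i + k)) #> comm G x y"
proof -
  have "M (Suc (i + k)) #> comm G x' y' = M (Suc (i + k)) #> comm G x y"
    if "x' \<in> lower_central G (Suc i) #> x" "y' \<in> M (Suc k) #> y" for x' y'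
  proof -
    from that obtain c d where c: "c \<in> lower_central G (Suc i)" "x' = c \<otimes> x"
      and d: "d \<in> M (Suc k)" "y' = d \<otimes> y" by (auto simp: r_coset_def)
    have x': "x' \<in> lower_central G i" "lower_central G (Suc i) #> x' = lower_central G (Suc i) #> x"
      using c assms lower_central_antimono[of i] r_coset_absorb[OF lower_central_normal]
        subgroup.m_closed[OF normal_imp_subgroup[OF lower_central_normal]] by auto
    have y': "y' \<in> M k" "M (Suc k) #> y' = M (Suc k) #> y"
      using d assms M_antimono[of k] r_coset_absorb[OF M_normal]
        subgroup.m_closed[OF normal_imp_subgroup[OF M_normal]] by auto
    show ?thesis
      using comm_cong_left_mod[OF assms(1,2) y'(1) x'] comm_cong_right_mod[OF assms y'] by simp
  qed
  moreover have "x \<in> lower_central G (Suc i) #> x" "y \<in> M (Suc k) #> y"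
    using assms by (blast intro: rcos_self normal_imp_subgroup lower_central_normal M_normal)+
  ultimately show ?thesis by fast
qed

text \<open>
  The factors of the Hall--Witt identity lie in \<open>M\<^sub>i\<^sub>+\<^sub>j\<^sub>+\<^sub>k\<close>, so modulo \<open>M\<^sub>i\<^sub>+\<^sub>j\<^sub>+\<^sub>k\<^sub>+\<^sub>1\<close> its conjugations can be
  dropped, and its inverses can be moved out of the commutators. The result is stated as a derivation
  rule, with \<open>z\<close> as the argument on the right throughout, because only \<open>z\<close> comes from the chain \<open>M\<close>. For
  \<open>M = \<gamma>\<close> this is the Jacobi identity, for the upper central series it is the module identity.
\<close>

lemma jacobi_mod:
  assumes "0 < i" "x \<in> lower_central G i" "0 < j" "y \<in> lower_central G j" "z \<in> M k"
  shows "M (Suc (i + j + k)) #> comm G (comm G x y) z =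
    M (Suc (i + j + k)) #> (comm G x (comm G y z) \<otimes> inv (comm G y (comm G x z)))"
proof -
  interpret L: central_filtration G "lower_central G" by (rule lower_central_filtration)
  let ?N = "M (Suc (i + j + k))"
  note [simp] = assms
  have [simp]: "x \<in> carrier G" "y \<in> carrier G" "z \<in> carrier G" using assms by blast+
  have N: "?N \<lhd> G" by (rule M_normal)
  have xy: "comm G x y \<in> lower_central G (i + j)" and xy': "comm G x (inv y) \<in> lower_central G (i + j)"
    by (simp_all add: L.comm_lower_central_M L.M_inv)
  have yz: "comm G y z \<in> M (j + k)" "comm G y (inv z) \<in> M (j + k)"
    and xz: "comm G x z \<in> M (i + k)" "comm G (inv x) z \<in> M (i + k)"
    by (simp_all add: comm_lower_central_M M_inv L.M_inv)
  define u where "u = comm G (comm G x (inv y)) z"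
  define v where "v = comm G (comm G y (inv z)) x"
  define w where "w = comm G (comm G z (inv x)) y"
  have [simp]: "u \<in> carrier G" "v \<in> carrier G" "w \<in> carrier G" by (simp_all add: u_def v_def w_def)

  have "?N #> u = ?N #> comm G (inv (comm G x y)) z"
    using comm_cong_left_mod[of "i + j" "inv (comm G x y)" z k "comm G x (inv y)"]
      L.comm_inv_right_mod[of i x y j] xy xy' L.M_inv by (simp add: u_def)
  also have "\<dots> = ?N #> inv (comm G (comm G x y) z)"
    using comm_inv_left_mod[of "i + j" "comm G x y" z k] xy by simp
  finally have u: "?N #> u = ?N #> inv (comm G (comm G x y) z)" .

  have "?N #> comm G x (comm G y (inv z)) = ?N #> comm G x (inv (comm G y z))"
    using comm_cong_right_mod[of i x "inv (comm G y z)" "j + k" "comm G y (inv z)"]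
      comm_inv_right_mod[of j y z k] yz M_inv by (simp add: add.assoc)
  also have "\<dots> = ?N #> inv (comm G x (comm G y z))"
    using comm_inv_right_mod[of i x "comm G y z" "j + k"] yz by (simp add: add.assoc)
  finally have "?N #> inv (comm G x (comm G y (inv z))) = ?N #> inv (inv (comm G x (comm G y z)))"
    by (intro r_coset_inv_cong[OF N]) auto
  then have v: "?N #> v = ?N #> comm G x (comm G y z)" by (simp add: v_def inv_commutator)

  have "M (Suc (i + k)) #> inv (comm G (inv x) z) = M (Suc (i + k)) #> inv (inv (comm G x z))"
    using comm_inv_left_mod[of i x z k] by (intro r_coset_inv_cong[OF M_normal]) auto
  then have "?N #> comm G y (comm G z (inv x)) = ?N #> comm G y (comm G x z)"
    using comm_cong_right_mod[of j y "comm G x z" "i + k" "comm G z (inv x)"] xz M_inv[OF xz(2)]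
    by (simp add: inv_commutator ac_simps)
  then have "?N #> inv (comm G y (comm G z (inv x))) = ?N #> inv (comm G y (comm G x z))"
    by (intro r_coset_inv_cong[OF N]) auto
  then have w: "?N #> w = ?N #> inv (comm G y (comm G x z))" by (simp add: w_def inv_commutator)

  \<comment> \<open>the three factors are central modulo \<open>?N\<close>, so the conjugations in the Hall--Witt identity disappear\<close>
  have top: "u \<in> M (i + j + k)" "v \<in> M (i + j + k)" "w \<in> M (i + j + k)"
  proof -
    show "u \<in> M (i + j + k)" unfolding u_def using xy' comm_lower_central_M[of "i + j"] by simp
    have "comm G x (comm G y (inv z)) \<in> M (i + (j + k))" using yz comm_lower_central_M[of i] by simp
    then show "v \<in> M (i + j + k)"
      unfolding v_def using comm_mem_swap[OF M_normal, of x "comm G y (inv z)"] by (simp add: add.assoc)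
    have "comm G z (inv x) \<in> M (i + k)" using xz(2) comm_mem_swap[OF M_normal, of "inv x" z] by simp
    then have "comm G y (comm G z (inv x)) \<in> M (j + (i + k))" using comm_lower_central_M[of j] by simp
    then show "w \<in> M (i + j + k)"
      unfolding w_def using comm_mem_swap[OF M_normal, of y "comm G z (inv x)"] by (simp add: ac_simps)
  qed
  have conj: "?N #> (inv g \<otimes> h \<otimes> g) = ?N #> h" if "h \<in> M (i + j + k)" "g \<in> carrier G" for g h
    using that comm_M_Suc' by (intro r_coset_conj[OF N]) auto
  have "?N #> ((inv y \<otimes> u \<otimes> y) \<otimes> (inv z \<otimes> v \<otimes> z) \<otimes> (inv x \<otimes> w \<otimes> x)) = ?N #> \<one>"
    unfolding u_def v_def w_def by (subst Hall_Witt) simp_all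
  then have "(?N #> (inv y \<otimes> u \<otimes> y)) <#> (?N #> (inv z \<otimes> v \<otimes> z)) <#> (?N #> (inv x \<otimes> w \<otimes> x)) = ?N #> \<one>"
    by (simp flip: r_coset_mult[OF N])
  then have "?N #> (u \<otimes> v \<otimes> w) = ?N #> \<one>"
    by (simp add: conj top) (simp add: r_coset_mult[OF N])
  then have "?N #> (inv (comm G (comm G x y) z) \<otimes> comm G x (comm G y z) \<otimes> inv (comm G y (comm G x z))) = ?N #> \<one>"
    by (simp add: r_coset_mult[OF N] u v w)
  then have "?N #> (comm G (comm G x y) z \<otimes> (inv (comm G (comm G x y) z) \<otimes> comm G x (comm G y z) \<otimes> inv (comm G y (comm G x z))))
      = ?N #> (comm G (comm G x y) z \<otimes> \<one>)"
    by (subst (1 2) r_coset_mult[OF N]) simp_all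
  then show ?thesis by (simp add: m_assoc cancel_left)
qed

end

section \<open>Pairings of graded abelian groups\<close>

lemma biadditive_closed:
  "\<lbrakk>biadditive A B C f; a \<in> carrier A; b \<in> carrier B\<rbrakk> \<Longrightarrow> f a b \<in> carrier C"
  by (simp add: biadditive_def)

lemma biadditive_mult_left:
  "\<lbrakk>biadditive A B C f; a \<in> carrier A; a' \<in> carrier A; b \<in> carrier B\<rbrakk>
    \<Longrightarrow> f (a \<otimes>\<^bsub>A\<^esub> a') b = f a b \<otimes>\<^bsub>C\<^esub> f a' b"
  by (simp add: biadditive_def)

lemma biadditive_mult_right:
  "\<lbrakk>biadditive A B C f; a \<in> carrier A; b \<in> carrier B; b' \<in> carrier B\<rbrakk>
    \<Longrightarrow> f a (b \<otimes>\<^bsub>B\<^esub> b') = f a b \<otimes>\<^bsub>C\<^esub> f a b'"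
  by (simp add: biadditive_def)

lemma biadditive_one_left:
  assumes "biadditive A B C f" "group A" "group C" "b \<in> carrier B"
  shows "f \<one>\<^bsub>A\<^esub> b = \<one>\<^bsub>C\<^esub>"
  using assms hom_one[of "\<lambda>a. f a b" A C] by (simp add: biadditive_def hom_def)

lemma biadditive_one_right:
  assumes "biadditive A B C f" "group B" "group C" "a \<in> carrier A"
  shows "f a \<one>\<^bsub>B\<^esub> = \<one>\<^bsub>C\<^esub>"
  using assms hom_one[of "f a" B C] by (simp add: biadditive_def hom_def)

lemma biadditive_inv_right:
  assumes "biadditive A B C f" "group B" "group C" "a \<in> carrier A" "b \<in> carrier B"
  shows "f a (inv\<^bsub>B\<^esub> b) = inv\<^bsub>C\<^esub> (f a b)"
proof -
  interpret group_hom B C "f a"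
    using assms by (intro group_hom.intro group_hom_axioms.intro) (simp_all add: biadditive_def hom_def)
  show ?thesis using assms by simp
qed

locale graded_comm_group =
  fixes V :: "nat \<Rightarrow> 'v monoid"
  assumes comm_group_V: "0 < i \<Longrightarrow> comm_group (V i)"
begin

lemma group_V: "0 < i \<Longrightarrow> group (V i)"
  using comm_group_V comm_group.axioms(2) by blast

lemma carrier_iff:
  "u \<in> carrier (graded_sum V) \<longleftrightarrow>
    u \<in> extensional {0<..} \<and> (\<forall>k>0. u k \<in> carrier (V k)) \<and> finite {k. 0 < k \<and> u k \<noteq> \<one>\<^bsub>V k\<^esub>}"
  by (subst carrier_sum_group) (auto simp: group_V PiE_iff Collect_conj_eq)

lemma group_graded_sum: "group (graded_sum V)"
  by (rule sum_group) (simp add: group_V)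

lemma comm_group_graded_sum: "comm_group (graded_sum V)"
proof (rule group.group_comm_groupI[OF group_graded_sum])
  fix x y assume "x \<in> carrier (graded_sum V)" "y \<in> carrier (graded_sum V)"
  then show "x \<otimes>\<^bsub>graded_sum V\<^esub> y = y \<otimes>\<^bsub>graded_sum V\<^esub> x"
    using comm_group_V by (auto simp: carrier_iff comm_groupE(4) intro!: restrict_ext)
qed

definition single :: "nat \<Rightarrow> 'v \<Rightarrow> nat \<Rightarrow> 'v" where
  "single i x = (\<lambda>k\<in>{0<..}. if k = i then x else \<one>\<^bsub>V k\<^esub>)"

lemma single_at: "0 < k \<Longrightarrow> single i x k = (if k = i then x else \<one>\<^bsub>V k\<^esub>)"
  by (simp add: single_def)

lemma single_closed: "x \<in> carrier (V i) \<Longrightarrow> single i x \<in> carrier (graded_sum V)"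
  using group_V by (auto simp: carrier_iff single_def group.is_monoid monoid.one_closed
      intro: finite_subset[of _ "{i}"])

lemma single_one: "single i \<one>\<^bsub>V i\<^esub> = \<one>\<^bsub>graded_sum V\<^esub>"
  by (auto simp: single_def)

lemma single_mult:
  assumes "0 < i"
  shows "single i x \<otimes>\<^bsub>graded_sum V\<^esub> single i y = single i (x \<otimes>\<^bsub>V i\<^esub> y)"
  using assms group_V by (auto simp: single_def group.is_monoid monoid.one_closed monoid.l_one)

lemma single_inv:
  assumes "0 < i" "x \<in> carrier (V i)"
  shows "inv\<^bsub>graded_sum V\<^esub> single i x = single i (inv\<^bsub>V i\<^esub> x)"
  using assms group_V single_closed[OF assms(2)]
  by (subst inv_sum_group) (auto simp: single_def group.is_monoid monoid.inv_one)

lemma single_homogeneous: "x \<in> carrier (V i) \<Longrightarrow> single i x \<in> homogeneous V i"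
  by (simp add: homogeneous_def single_closed single_at)

lemma homogeneousE:
  assumes "u \<in> homogeneous V i" "0 < i"
  obtains x where "x \<in> carrier (V i)" "u = single i x"
proof
  show "u i \<in> carrier (V i)" using assms by (simp add: homogeneous_def carrier_iff)
  show "u = single i (u i)"
  proof
    fix k show "u k = single i (u i) k"
      using assms by (cases "0 < k") (auto simp: homogeneous_def carrier_iff single_def extensional_def)
  qed
qed

text \<open>
  The homogeneous elements generate the direct sum. This reduces identities that are additive in each
  argument to homogeneous arguments.
\<close>

lemma graded_sum_induct [consumes 1, case_names single mult]:
  assumes "u \<in> carrier (graded_sum V)"
    and single: "\<And>i x. \<lbrakk>0 < i; x \<in> carrier (V i)\<rbrakk> \<Longrightarrow> P (single i x)"
    and mult: "\<And>a b. \<lbrakk>a \<in> carrier (graded_sum V); b \<in> carrier (graded_sum V); P a; P b\<rbrakk>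
      \<Longrightarrow> P (a \<otimes>\<^bsub>graded_sum V\<^esub> b)"
  shows "P u"
proof -
  have "P u" if "finite S" "u \<in> carrier (graded_sum V)" "{k. 0 < k \<and> u k \<noteq> \<one>\<^bsub>V k\<^esub>} \<subseteq> S" for S u
    using that
  proof (induction S arbitrary: u rule: finite_induct)
    case empty
    then have "u k = \<one>\<^bsub>V k\<^esub>" if "0 < k" for k using that by blast
    moreover have "u k = undefined" if "\<not> 0 < k" for k
      using empty that by (simp add: carrier_iff extensional_def)
    ultimately have "u = single 1 \<one>\<^bsub>V 1\<^esub>" by (auto simp: single_def)
    then show ?case using single[of 1 "\<one>\<^bsub>V 1\<^esub>"] group_V[of 1] by (simp add: group.is_monoid monoid.one_closed)
  next
    case (insert i S)
    show ?case
    proof (cases "0 < i")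
      case True
      define w where "w = (\<lambda>k. if k = i then \<one>\<^bsub>V k\<^esub> else u k)"
      have u: "u \<in> extensional {0<..}" "\<forall>k>0. u k \<in> carrier (V k)"
        "finite {k. 0 < k \<and> u k \<noteq> \<one>\<^bsub>V k\<^esub>}" using insert.prems(1) by (simp_all add: carrier_iff)
      have "{k. 0 < k \<and> w k \<noteq> \<one>\<^bsub>V k\<^esub>} \<subseteq> {k. 0 < k \<and> u k \<noteq> \<one>\<^bsub>V k\<^esub>}" by (auto simp: w_def)
      then have "finite {k. 0 < k \<and> w k \<noteq> \<one>\<^bsub>V k\<^esub>}" using u(3) finite_subset by blast
      then have w: "w \<in> carrier (graded_sum V)"
        unfolding carrier_iff using u True group_V
        by (auto simp: w_def extensional_def group.is_monoid monoid.one_closed)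
      have ui: "u i \<in> carrier (V i)" using insert.prems True by (simp add: carrier_iff)
      have "u = w \<otimes>\<^bsub>graded_sum V\<^esub> single i (u i)"
      proof
        fix k show "u k = (w \<otimes>\<^bsub>graded_sum V\<^esub> single i (u i)) k"
          using insert.prems(1) group_V[of k]
          by (cases "0 < k") (auto simp: w_def single_def carrier_iff extensional_def
              group.is_monoid monoid.l_one monoid.r_one)
      qed
      moreover have "P w" using insert.prems by (intro insert.IH w) (auto simp: w_def)
      ultimately show ?thesis using mult[OF w single_closed[OF ui]] single[OF True ui] by metis
    next
      case False
      then show ?thesis using insert by auto
    qed
  qed
  then show ?thesis using assms(1) by (auto simp: carrier_iff)
qed

end

locale graded_pairing = L: graded_comm_group L + V: graded_comm_group V
  for L :: "nat \<Rightarrow> 'a monoid" and V :: "nat \<Rightarrow> 'v monoid" +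
  fixes m :: "nat \<Rightarrow> nat \<Rightarrow> 'a \<Rightarrow> 'v \<Rightarrow> 'v"
  assumes m_biadditive: "\<lbrakk>0 < i; 0 < j\<rbrakk> \<Longrightarrow> biadditive (L i) (V j) (V (i + j)) (m i j)"
begin

abbreviation "act \<equiv> graded_extension V m"

lemma m_biadditive':
  assumes "0 < i" "i < k"
  shows "biadditive (L i) (V (k - i)) (V k) (m i (k - i))"
  using m_biadditive[of i "k - i"] assms by simp

lemma act_at: "0 < k \<Longrightarrow> act u v k = finprod (V k) (\<lambda>i. m i (k - i) (u i) (v (k - i))) {0<..<k}"
  by (simp add: graded_extension_def)

lemma term_closed:
  assumes "u \<in> carrier (graded_sum L)" "v \<in> carrier (graded_sum V)" "0 < i" "i < k"
  shows "m i (k - i) (u i) (v (k - i)) \<in> carrier (V k)"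
  using assms by (intro biadditive_closed[OF m_biadditive']) (simp_all add: L.carrier_iff V.carrier_iff)

lemma act_closed:
  assumes u: "u \<in> carrier (graded_sum L)" and v: "v \<in> carrier (graded_sum V)"
  shows "act u v \<in> carrier (graded_sum V)"
  unfolding V.carrier_iff
proof (intro conjI allI impI)
  show "act u v \<in> extensional {0<..}" by (simp add: graded_extension_def)
  fix k :: nat assume k: "0 < k"
  interpret comm_group "V k" using k by (rule V.comm_group_V)
  show "act u v k \<in> carrier (V k)"
    unfolding act_at[OF k] using assms by (intro finprod_closed) (auto intro: term_closed)
next
  let ?S = "{k. 0 < k \<and> u k \<noteq> \<one>\<^bsub>L k\<^esub>}" and ?T = "{k. 0 < k \<and> v k \<noteq> \<one>\<^bsub>V k\<^esub>}"
  have "act u v k = \<one>\<^bsub>V k\<^esub>" if k: "0 < k" and ex: "\<not> (\<exists>i\<in>?S. \<exists>j\<in>?T. k = i + j)" for k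
  proof -
    interpret comm_group "V k" using k by (rule V.comm_group_V)
    show ?thesis
      unfolding act_at[OF k]
    proof (rule finprod_one_eqI)
      fix i assume i: "i \<in> {0<..<k}"
      have ui: "u i \<in> carrier (L i)" and vi: "v (k - i) \<in> carrier (V (k - i))"
        using u v i by (auto simp: L.carrier_iff V.carrier_iff)
      have "u i = \<one>\<^bsub>L i\<^esub> \<or> v (k - i) = \<one>\<^bsub>V (k - i)\<^esub>"
      proof (rule ccontr)
        assume "\<not> ?thesis"
        then have "i \<in> ?S" "k - i \<in> ?T" using i by simp_all
        moreover have "k = i + (k - i)" using i by simp
        ultimately show False using ex by blast
      qed
      then show "m i (k - i) (u i) (v (k - i)) = \<one>\<^bsub>V k\<^esub>"
        using biadditive_one_left[OF m_biadditive' L.group_V is_group vi]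
          biadditive_one_right[OF m_biadditive' V.group_V is_group ui] i by auto
    qed
  qed
  then have "{k. 0 < k \<and> act u v k \<noteq> \<one>\<^bsub>V k\<^esub>} \<subseteq> (\<Union>i\<in>?S. (+) i ` ?T)" by blast
  moreover have "finite (\<Union>i\<in>?S. (+) i ` ?T)"
    using u v unfolding L.carrier_iff V.carrier_iff by blast
  ultimately show "finite {k. 0 < k \<and> act u v k \<noteq> \<one>\<^bsub>V k\<^esub>}"
    using finite_subset by blast
qed

lemma act_biadditive: "biadditive (graded_sum L) (graded_sum V) (graded_sum V) act"
  unfolding biadditive_def
proof (intro conjI ballI)
  fix u v assume uv: "u \<in> carrier (graded_sum L)" "v \<in> carrier (graded_sum V)"
  then show "act u v \<in> carrier (graded_sum V)" by (rule act_closed)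
  {
    fix u' assume u': "u' \<in> carrier (graded_sum L)"
    show "act (u \<otimes>\<^bsub>graded_sum L\<^esub> u') v = act u v \<otimes>\<^bsub>graded_sum V\<^esub> act u' v"
    proof
      fix k :: nat
      show "act (u \<otimes>\<^bsub>graded_sum L\<^esub> u') v k = (act u v \<otimes>\<^bsub>graded_sum V\<^esub> act u' v) k"
      proof (cases "0 < k")
        case k: True
        interpret comm_group "V k" using k by (rule V.comm_group_V)
        have "act (u \<otimes>\<^bsub>graded_sum L\<^esub> u') v k = finprod (V k)
           (\<lambda>i. m i (k - i) (u i) (v (k - i)) \<otimes>\<^bsub>V k\<^esub> m i (k - i) (u' i) (v (k - i))) {0<..<k}"
          unfolding act_at[OF k] using uv u'
          by (intro finprod_cong' refl) (auto simp: term_closed L.carrier_iff V.carrier_iff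
              intro!: biadditive_mult_left[OF m_biadditive'] m_closed term_closed)
        then show ?thesis
          using uv u' k by (simp add: act_at) (intro finprod_multf; auto intro: term_closed)
      qed (simp add: graded_extension_def)
    qed
  }
  {
    fix v' assume v': "v' \<in> carrier (graded_sum V)"
    show "act u (v \<otimes>\<^bsub>graded_sum V\<^esub> v') = act u v \<otimes>\<^bsub>graded_sum V\<^esub> act u v'"
    proof
      fix k :: nat
      show "act u (v \<otimes>\<^bsub>graded_sum V\<^esub> v') k = (act u v \<otimes>\<^bsub>graded_sum V\<^esub> act u v') k"
      proof (cases "0 < k")
        case k: True
        interpret comm_group "V k" using k by (rule V.comm_group_V)
        have "act u (v \<otimes>\<^bsub>graded_sum V\<^esub> v') k = finprod (V k)
           (\<lambda>i. m i (k - i) (u i) (v (k - i)) \<otimes>\<^bsub>V k\<^esub> m i (k - i) (u i) (v' (k - i))) {0<..<k}"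
          unfolding act_at[OF k] using uv v'
          by (intro finprod_cong' refl) (auto simp: term_closed L.carrier_iff V.carrier_iff
              intro!: biadditive_mult_right[OF m_biadditive'] m_closed term_closed)
        then show ?thesis
          using uv v' k by (simp add: act_at) (intro finprod_multf; auto intro: term_closed)
      qed (simp add: graded_extension_def)
    qed
  }
qed

lemma act_single:
  assumes "0 < i" "0 < j" "x \<in> carrier (L i)" "y \<in> carrier (V j)"
  shows "act (L.single i x) (V.single j y) = V.single (i + j) (m i j x y)"
proof
  fix k :: nat
  show "act (L.single i x) (V.single j y) k = V.single (i + j) (m i j x y) k"
  proof (cases "0 < k")
    case k: True
    interpret comm_group "V k" using k by (rule V.comm_group_V)
    let ?f = "\<lambda>p. m p (k - p) (L.single i x p) (V.single j y (k - p))"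
    have f: "?f p = (if p = i \<and> k = i + j then m i j x y else \<one>\<^bsub>V k\<^esub>)" if p: "p \<in> {0<..<k}" for p
    proof -
      have c: "L.single i x p \<in> carrier (L p)" "V.single j y (k - p) \<in> carrier (V (k - p))"
        using L.single_closed[OF assms(3)] V.single_closed[OF assms(4)] p
        by (simp_all add: L.carrier_iff V.carrier_iff)
      consider "p \<noteq> i" | "p = i" "k - p \<noteq> j" | "p = i" "k = i + j" using p by fastforce
      then show ?thesis
      proof cases
        case 1
        then show ?thesis
          using p c biadditive_one_left[OF m_biadditive' L.group_V is_group, of p] by (simp add: L.single_at)
      next
        case 2
        then show ?thesis
          using p c biadditive_one_right[OF m_biadditive' V.group_V is_group, of p]
          by (auto simp: V.single_at)
      next
        case 3
        then show ?thesis using assms by (simp add: L.single_at V.single_at)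
      qed
    qed
    show ?thesis
    proof (cases "k = i + j")
      case True
      have "finprod (V k) ?f {0<..<k} = finprod (V k) (\<lambda>p. if i = p then m i j x y else \<one>\<^bsub>V k\<^esub>) {0<..<k}"
        using True f one_closed biadditive_closed[OF m_biadditive assms(3,4)] assms
        by (intro finprod_cong' refl) auto
      also have "\<dots> = m i j x y"
        using True biadditive_closed[OF m_biadditive assms(3,4)] assms
        by (intro finprod_singleton) auto
      finally show ?thesis using True k by (simp add: act_at V.single_at)
    next
      case False
      then have "finprod (V k) ?f {0<..<k} = \<one>\<^bsub>V k\<^esub>" using f by (intro finprod_one_eqI) simp
      then show ?thesis using False k by (simp add: act_at V.single_at)
    qed
  qed (simp add: graded_extension_def V.single_def)
qed

lemma act_homogeneous:
  assumes "0 < i" "0 < j" "u \<in> homogeneous L i" "v \<in> homogeneous V j"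
  shows "act u v \<in> homogeneous V (i + j)"
proof -
  obtain x y where "x \<in> carrier (L i)" "u = L.single i x" "y \<in> carrier (V j)" "v = V.single j y"
    using assms L.homogeneousE V.homogeneousE by metis
  then show ?thesis
    using assms act_single biadditive_closed[OF m_biadditive] V.single_homogeneous by simp
qed

end

text \<open>
  The module identity, stated degree by degree on the components. For \<open>V = L\<close> and \<open>m = l\<close> it is the
  Jacobi identity of a bracket that is skew-symmetric, so one statement serves ring and modules.
\<close>

locale graded_derivation_pairing = graded_pairing L V m + br: graded_pairing L L l
  for L :: "nat \<Rightarrow> 'a monoid" and V :: "nat \<Rightarrow> 'v monoid"
    and l :: "nat \<Rightarrow> nat \<Rightarrow> 'a \<Rightarrow> 'a \<Rightarrow> 'a" and m :: "nat \<Rightarrow> nat \<Rightarrow> 'a \<Rightarrow> 'v \<Rightarrow> 'v" +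
  assumes m_bracket: "\<lbrakk>0 < i; 0 < j; 0 < k; x \<in> carrier (L i); y \<in> carrier (L j); z \<in> carrier (V k)\<rbrakk>
    \<Longrightarrow> m (i + j) k (l i j x y) z =
      m i (j + k) x (m j k y z) \<otimes>\<^bsub>V (i + j + k)\<^esub> inv\<^bsub>V (i + j + k)\<^esub> m j (i + k) y (m i k x z)"
begin

text \<open>
  Both sides are additive in \<open>a\<close>, \<open>b\<close> and \<open>v\<close>, so three nested inductions reduce the identity to homogeneous
  elements, where it is the hypothesis on the components.
\<close>

lemma act_bracket:
  assumes a: "a \<in> carrier (graded_sum L)" and b: "b \<in> carrier (graded_sum L)"
    and v: "v \<in> carrier (graded_sum V)"
  shows "act (br.act a b) v =
    act a (act b v) \<otimes>\<^bsub>graded_sum V\<^esub> inv\<^bsub>graded_sum V\<^esub> act b (act a v)"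
proof -
  interpret S: comm_group "graded_sum V" by (rule V.comm_group_graded_sum)
  note close = act_closed br.act_closed S.m_closed S.inv_closed
  note add = biadditive_mult_left[OF act_biadditive] biadditive_mult_right[OF act_biadditive]
    biadditive_mult_left[OF br.act_biadditive] biadditive_mult_right[OF br.act_biadditive]
  note [simp del] = mult_sum_group inv_sum_group
  show ?thesis
    using a b v
  proof (induction a arbitrary: b v rule: L.graded_sum_induct)
    case (mult a a')
    then show ?case by (simp add: add close S.inv_mult) (simp add: close S.m_ac)
  next
    case (single i x)
    note x = single
    show ?case
      using x(3,4)
    proof (induction b arbitrary: v rule: L.graded_sum_induct)
      case (mult b b')
      then show ?case
        using L.single_closed[OF x(2)] by (simp add: add close S.inv_mult) (simp add: close S.m_ac)
    next
      case (single j y)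
      note y = single
      show ?case
        using y(3)
      proof (induction v rule: V.graded_sum_induct)
        case (mult v v')
        then show ?case
          using L.single_closed[OF x(2)] L.single_closed[OF y(2)]
          by (simp add: add close S.inv_mult) (simp add: close S.m_ac)
      next
        case (single k z)
        have c: "m j k y z \<in> carrier (V (j + k))" "m i k x z \<in> carrier (V (i + k))"
          "l i j x y \<in> carrier (L (i + j))"
          using x y single biadditive_closed m_biadditive br.m_biadditive by metis+
        have c': "m i (j + k) x (m j k y z) \<in> carrier (V (i + j + k))"
          "m j (i + k) y (m i k x z) \<in> carrier (V (i + j + k))"
          using x y single c biadditive_closed[OF m_biadditive, of i "j + k"]
            biadditive_closed[OF m_biadditive, of j "i + k"] by (simp_all add: ac_simps)
        show ?case
          using x y single c c' m_bracket
          by (simp add: act_single br.act_single)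
             (simp add: ac_simps V.single_inv V.single_mult)
      qed
    qed
  qed
qed

end

text \<open>
  In different degrees skew-symmetry does not follow from \<open>alternating\<close>, which only concerns products of
  elements of the same component. On the direct sum, \<open>(a + b) \<circ> (a + b)\<close> vanishes because the mixed terms
  cancel by skew-symmetry, and skew-symmetry turns the derivation rule into the cyclic Jacobi identity.
\<close>

lemma graded_lie_ring_graded_extension:
  assumes "graded_derivation_pairing L L l l"
    and alternating: "\<And>i x. \<lbrakk>0 < i; x \<in> carrier (L i)\<rbrakk> \<Longrightarrow> l i i x x = \<one>\<^bsub>L (i + i)\<^esub>"
    and skew: "\<And>i j x y. \<lbrakk>0 < i; 0 < j; x \<in> carrier (L i); y \<in> carrier (L j)\<rbrakk> \<Longrightarrow>
      l i j x y \<otimes>\<^bsub>L (i + j)\<^esub> l j i y x = \<one>\<^bsub>L (i + j)\<^esub>"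
  shows "graded_lie_ring L (graded_extension L l)"
proof -
  interpret graded_derivation_pairing L L l l by fact
  interpret S: comm_group "graded_sum L" by (rule L.comm_group_graded_sum)
  note [simp del] = mult_sum_group inv_sum_group one_sum_group
  note add = biadditive_mult_left[OF act_biadditive] biadditive_mult_right[OF act_biadditive]
  have skew': "act a b \<otimes>\<^bsub>graded_sum L\<^esub> act b a = \<one>\<^bsub>graded_sum L\<^esub>"
    if "a \<in> carrier (graded_sum L)" "b \<in> carrier (graded_sum L)" for a b
    using that
  proof (induction a arbitrary: b rule: L.graded_sum_induct)
    case (mult a a')
    then have "act a b \<otimes>\<^bsub>graded_sum L\<^esub> act b a = \<one>\<^bsub>graded_sum L\<^esub>"
      "act a' b \<otimes>\<^bsub>graded_sum L\<^esub> act b a' = \<one>\<^bsub>graded_sum L\<^esub>" by blast+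
    moreover have "act (a \<otimes>\<^bsub>graded_sum L\<^esub> a') b \<otimes>\<^bsub>graded_sum L\<^esub> act b (a \<otimes>\<^bsub>graded_sum L\<^esub> a')
       = (act a b \<otimes>\<^bsub>graded_sum L\<^esub> act b a) \<otimes>\<^bsub>graded_sum L\<^esub> (act a' b \<otimes>\<^bsub>graded_sum L\<^esub> act b a')"
      using mult by (simp add: add act_closed S.m_ac)
    ultimately show ?case by simp
  next
    case (single i x)
    note x = single
    show ?case
      using x(3)
    proof (induction b rule: L.graded_sum_induct)
      case (mult a a')
      let ?b = "L.single i x"
      have "act ?b (a \<otimes>\<^bsub>graded_sum L\<^esub> a') \<otimes>\<^bsub>graded_sum L\<^esub> act (a \<otimes>\<^bsub>graded_sum L\<^esub> a') ?b
         = (act ?b a \<otimes>\<^bsub>graded_sum L\<^esub> act a ?b) \<otimes>\<^bsub>graded_sum L\<^esub> (act ?b a' \<otimes>\<^bsub>graded_sum L\<^esub> act a' ?b)"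
        using mult L.single_closed[OF x(2)] by (simp add: add act_closed S.m_ac)
      then show ?case using mult by simp
    next
      case (single j y)
      then show ?case
        using x skew by (simp add: act_single add.commute[of j i] L.single_mult L.single_one)
    qed
  qed
  have "act a a = \<one>\<^bsub>graded_sum L\<^esub>" if "a \<in> carrier (graded_sum L)" for a
    using that
  proof (induction a rule: L.graded_sum_induct)
    case (single i x)
    then show ?case by (simp add: act_single alternating L.single_one)
  next
    case (mult a b)
    have "act (a \<otimes>\<^bsub>graded_sum L\<^esub> b) (a \<otimes>\<^bsub>graded_sum L\<^esub> b) =
       (act a a \<otimes>\<^bsub>graded_sum L\<^esub> act b b) \<otimes>\<^bsub>graded_sum L\<^esub> (act a b \<otimes>\<^bsub>graded_sum L\<^esub> act b a)"
      using mult(1,2) by (simp add: add act_closed S.m_ac)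
    then show ?case using mult skew' by simp
  qed
  moreover have "act a (act b c) \<otimes>\<^bsub>graded_sum L\<^esub> act b (act c a) \<otimes>\<^bsub>graded_sum L\<^esub> act c (act a b) = \<one>\<^bsub>graded_sum L\<^esub>"
    if abc: "a \<in> carrier (graded_sum L)" "b \<in> carrier (graded_sum L)" "c \<in> carrier (graded_sum L)" for a b c
  proof -
    have sw: "act y x = inv\<^bsub>graded_sum L\<^esub> act x y"
      if "x \<in> carrier (graded_sum L)" "y \<in> carrier (graded_sum L)" for x y
      using that skew'[of y x] by (simp add: act_closed S.inv_equality)
    have "act c (act a b) = inv\<^bsub>graded_sum L\<^esub> (act a (act b c) \<otimes>\<^bsub>graded_sum L\<^esub> inv\<^bsub>graded_sum L\<^esub> act b (act a c))"
      using abc by (subst sw) (simp_all add: act_closed act_bracket)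
    moreover have "act b (act c a) = inv\<^bsub>graded_sum L\<^esub> act b (act a c)"
      using abc biadditive_inv_right[OF act_biadditive S.is_group S.is_group, of b "act a c"]
      by (simp add: sw[of a c] act_closed)
    ultimately show ?thesis using abc by (simp add: act_closed S.r_inv)
  qed
  ultimately show ?thesis
    using L.comm_group_V act_biadditive act_homogeneous by (intro graded_lie_ring.intro)
qed

lemma graded_lie_module_graded_extension:
  assumes "graded_lie_ring L (graded_extension L l)" "graded_derivation_pairing L V l m"
  shows "graded_lie_module L (graded_extension L l) V (graded_extension V m)"
proof -
  interpret graded_derivation_pairing L V l m by fact
  show ?thesis
    by (intro graded_lie_module.intro graded_lie_module_axioms.intro assms(1))
       (simp_all only: V.comm_group_V act_biadditive act_bracket act_homogeneous)
qed

text \<open>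
  Between two consecutive actions the isomorphism of the intermediate degree cancels against its
  inverse, so a module structure transports along isomorphisms chosen independently in each degree.
\<close>

lemma graded_derivation_pairing_transport:
  assumes "graded_derivation_pairing L V l m"
    and W: "\<And>i. 0 < i \<Longrightarrow> comm_group (W i)"
    and \<phi>: "\<And>i. 0 < i \<Longrightarrow> \<phi> i \<in> iso (W i) (V i)"
  shows "graded_derivation_pairing L W l
    (\<lambda>i j x w. inv_into (carrier (W (i + j))) (\<phi> (i + j)) (m i j x (\<phi> j w)))"
proof -
  interpret graded_derivation_pairing L V l m by fact
  define \<psi> where "\<psi> k = inv_into (carrier (W k)) (\<phi> k)" for k
  let ?n = "\<lambda>i j x w. \<psi> (i + j) (m i j x (\<phi> j w))"
  have hom: "\<phi> k \<in> hom (W k) (V k)" "\<psi> k \<in> hom (V k) (W k)" if "0 < k" for k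
    using \<phi>[OF that] group.iso_set_sym[OF comm_group.axioms(2)[OF W[OF that]] \<phi>[OF that]]
    by (simp_all add: \<psi>_def iso_imp_homomorphism)
  have \<phi>\<psi>: "\<phi> k (\<psi> k v) = v" if "0 < k" "v \<in> carrier (V k)" for k v
    using \<phi>[OF that(1)] that(2) by (simp add: \<psi>_def iso_def bij_betw_def f_inv_into_f)
  have \<phi>_closed: "\<phi> k w \<in> carrier (V k)" if "0 < k" "w \<in> carrier (W k)" for k w
    using hom(1) that by (metis hom_in_carrier)
  have \<psi>_closed: "\<psi> k v \<in> carrier (W k)" if "0 < k" "v \<in> carrier (V k)" for k v
    using hom(2) that by (metis hom_in_carrier)
  have W_group: "group (W k)" if "0 < k" for k using W[OF that] by (rule comm_group.axioms)
  have biadd: "biadditive (L i) (W j) (W (i + j)) (?n i j)" if ij: "0 < i" "0 < j" for i j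
    unfolding biadditive_def
    using ij by (simp add: \<phi>_closed \<psi>_closed biadditive_closed[OF m_biadditive] hom_mult[OF hom(1)]
        hom_mult[OF hom(2)] biadditive_mult_left[OF m_biadditive] biadditive_mult_right[OF m_biadditive])
  show ?thesis
    unfolding \<psi>_def[symmetric]
  proof (intro graded_derivation_pairing.intro graded_pairing.intro graded_comm_group.intro
      graded_pairing_axioms.intro graded_derivation_pairing_axioms.intro)
    fix i j k x y w
    assume ijk: "0 < i" "0 < j" "0 < k" and x: "x \<in> carrier (L i)" and y: "y \<in> carrier (L j)"
      and w: "w \<in> carrier (W k)"
    let ?z = "\<phi> k w"
    have z: "?z \<in> carrier (V k)" using ijk w \<phi>_closed by blast
    have c: "m j k y ?z \<in> carrier (V (j + k))" "m i k x ?z \<in> carrier (V (i + k))"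
      using ijk x y z biadditive_closed[OF m_biadditive] by blast+
    have c': "m i (j + k) x (m j k y ?z) \<in> carrier (V (i + j + k))"
      "m j (i + k) y (m i k x ?z) \<in> carrier (V (i + j + k))"
      using biadditive_closed[OF m_biadditive x c(1)] biadditive_closed[OF m_biadditive y c(2)] ijk
      by (simp_all add: ac_simps)
    interpret Vk: group "V (i + j + k)" using ijk by (intro V.group_V) simp
    interpret h: group_hom "V (i + j + k)" "W (i + j + k)" "\<psi> (i + j + k)"
      using ijk hom(2)[of "i + j + k"] W_group[of "i + j + k"] Vk.is_group
      by (intro group_hom.intro group_hom_axioms.intro) simp_all
    have "?n (i + j) k (l i j x y) w = \<psi> (i + j + k) (m i (j + k) x (m j k y ?z)
        \<otimes>\<^bsub>V (i + j + k)\<^esub> inv\<^bsub>V (i + j + k)\<^esub> m j (i + k) y (m i k x ?z))"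
      using m_bracket[OF ijk x y z] by simp
    also have "\<dots> = \<psi> (i + j + k) (m i (j + k) x (m j k y ?z))
        \<otimes>\<^bsub>W (i + j + k)\<^esub> inv\<^bsub>W (i + j + k)\<^esub> \<psi> (i + j + k) (m j (i + k) y (m i k x ?z))"
      using c' by simp
    finally show "?n (i + j) k (l i j x y) w = ?n i (j + k) x (?n j k y w)
        \<otimes>\<^bsub>W (i + j + k)\<^esub> inv\<^bsub>W (i + j + k)\<^esub> ?n j (i + k) y (?n i k x w)"
      using ijk c by (simp add: \<phi>\<psi> ac_simps)
  next
    fix i j :: nat
    assume "0 < i" "0 < j"
    then show "biadditive (L i) (W j) (W (i + j)) (?n i j)" by (rule biadd)
  qed (use W L.comm_group_V br.m_biadditive in blast)+
qed

section \<open>Brackets of cosets\<close>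

context central_filtration
begin

text \<open>
  For the lower central series, \<open>factor\<close> and \<open>bracket\<close> are the groups \<open>lower_factor G\<close> and the bracket
  \<open>lower_bracket G\<close>. For \<open>M k = upper_central G (n - k)\<close> they are \<open>upper_factor G (n - k)\<close> and
  \<open>upper_bracket G (n - (i + k))\<close>, as long as \<open>k < n\<close> and \<open>i + k < n\<close>.
\<close>

definition factor :: "nat \<Rightarrow> 'a set monoid" where
  "factor k = (G\<lparr>carrier := M k\<rparr>) Mod M (Suc k)"

lemma carrier_factor: "carrier (factor k) = (\<lambda>a. M (Suc k) #> a) ` M k"
  by (simp add: factor_def carrier_FactGroup)

lemma mult_factor: "a \<in> M k \<Longrightarrow> b \<in> M k \<Longrightarrow>
    (M (Suc k) #> a) \<otimes>\<^bsub>factor k\<^esub> (M (Suc k) #> b) = M (Suc k) #> (a \<otimes> b)"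
  using M_in_carrier by (simp add: factor_def r_coset_mult[OF M_normal])

lemma one_factor: "\<one>\<^bsub>factor k\<^esub> = M (Suc k)"
  by (simp add: factor_def)

lemma comm_group_factor: "comm_group (factor k)"
proof -
  have "M (Suc k) \<lhd> G\<lparr>carrier := M k\<rparr>"
    by (intro normal_restrict_supergroup normal_imp_subgroup M_normal M_antimono)
  then have grp: "group (factor k)"
    unfolding factor_def by (rule normal.factorgroup_is_group)
  then show ?thesis
  proof (rule group.group_comm_groupI)
    fix X Y assume "X \<in> carrier (factor k)" "Y \<in> carrier (factor k)"
    then obtain a b where "a \<in> M k" "X = M (Suc k) #> a" "b \<in> M k" "Y = M (Suc k) #> b"
      by (auto simp: carrier_factor)
    then show "X \<otimes>\<^bsub>factor k\<^esub> Y = Y \<otimes>\<^bsub>factor k\<^esub> X"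
      using r_coset_commute[OF M_normal, of a b] comm_M_Suc[of a b k] by (auto simp: mult_factor)
  qed
qed

lemma coset_closed: "a \<in> M k \<Longrightarrow> M (Suc k) #> a \<in> carrier (factor k)"
  by (simp add: carrier_factor)

lemma inv_factor:
  assumes "a \<in> M k"
  shows "inv\<^bsub>factor k\<^esub> (M (Suc k) #> a) = M (Suc k) #> inv a"
proof -
  interpret F: comm_group "factor k" by (rule comm_group_factor)
  have "(M (Suc k) #> inv a) \<otimes>\<^bsub>factor k\<^esub> (M (Suc k) #> a) = \<one>\<^bsub>factor k\<^esub>"
    using assms M_inv[OF assms] subgroup.subset[OF normal_imp_subgroup[OF M_normal]]
    by (auto simp: mult_factor one_factor)
  then show ?thesis using assms M_inv coset_closed by (intro F.inv_equality) auto
qed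

definition bracket :: "nat \<Rightarrow> nat \<Rightarrow> 'a set \<Rightarrow> 'a set \<Rightarrow> 'a set" where
  "bracket i k X Y = (\<Union>x\<in>X. \<Union>y\<in>Y. M (Suc (i + k)) #> comm G x y)"

lemma bracket_coset:
  assumes "0 < i" "x \<in> lower_central G i" "y \<in> M k"
  shows "bracket i k (lower_central G (Suc i) #> x) (M (Suc k) #> y) = M (Suc (i + k)) #> comm G x y"
  unfolding bracket_def by (rule comm_coset_mod[OF assms])

lemma lower_factor_cosetE:
  assumes "X \<in> carrier (lower_factor G i)"
  obtains x where "x \<in> lower_central G i" "X = lower_central G (Suc i) #> x"
  using assms by (auto simp: lower_factor_def carrier_FactGroup)

lemma factor_cosetE:
  assumes "Y \<in> carrier (factor k)"
  obtains y where "y \<in> M k" "Y = M (Suc k) #> y"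
  using assms by (auto simp: carrier_factor)

lemma bracket_biadditive:
  assumes i: "0 < i"
  shows "biadditive (lower_factor G i) (factor k) (factor (i + k)) (bracket i k)"
  unfolding biadditive_def
proof (intro conjI ballI)
  fix X Y assume "X \<in> carrier (lower_factor G i)" "Y \<in> carrier (factor k)"
  then obtain x y where x: "x \<in> lower_central G i" and X: "X = lower_central G (Suc i) #> x"
    and y: "y \<in> M k" and Y: "Y = M (Suc k) #> y" by (metis lower_factor_cosetE factor_cosetE)
  show "bracket i k X Y \<in> carrier (factor (i + k))"
    unfolding X Y using i x y by (simp add: bracket_coset coset_closed comm_lower_central_M)
  {
    fix X' assume "X' \<in> carrier (lower_factor G i)"
    then obtain x' where x': "x' \<in> lower_central G i" and X': "X' = lower_central G (Suc i) #> x'"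
      by (metis lower_factor_cosetE)
    have "X \<otimes>\<^bsub>lower_factor G i\<^esub> X' = lower_central G (Suc i) #> (x \<otimes> x')"
      unfolding X X' lower_factor_def
      using x x' lower_central_in_carrier by (simp add: r_coset_mult[OF lower_central_normal])
    moreover have "x \<otimes> x' \<in> lower_central G i"
      using x x' subgroup.m_closed[OF normal_imp_subgroup[OF lower_central_normal]] by blast
    ultimately show "bracket i k (X \<otimes>\<^bsub>lower_factor G i\<^esub> X') Y =
        bracket i k X Y \<otimes>\<^bsub>factor (i + k)\<^esub> bracket i k X' Y"
      unfolding X X' Y using i x x' y
      by (simp add: bracket_coset mult_factor comm_lower_central_M comm_mult_left_mod)
  }
  {
    fix Y' assume "Y' \<in> carrier (factor k)"
    then obtain y' where y': "y' \<in> M k" and Y': "Y' = M (Suc k) #> y'"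
      by (metis factor_cosetE)
    have "y \<otimes> y' \<in> M k"
      using y y' subgroup.m_closed[OF normal_imp_subgroup[OF M_normal]] by blast
    then show "bracket i k X (Y \<otimes>\<^bsub>factor k\<^esub> Y') =
        bracket i k X Y \<otimes>\<^bsub>factor (i + k)\<^esub> bracket i k X Y'"
      unfolding X Y Y' using i x y y'
      by (simp add: bracket_coset mult_factor comm_lower_central_M comm_mult_right_mod)
  }
qed

end

context group
begin

interpretation L: central_filtration G "lower_central G" by (rule lower_central_filtration)

lemma factor_lower: "L.factor = lower_factor G"
  by (simp add: fun_eq_iff L.factor_def lower_factor_def)

lemma bracket_lower: "L.bracket = lower_bracket G"
  by (simp add: fun_eq_iff L.bracket_def lower_bracket_def)

lemma lower_bracket_coset:
  assumes "0 < i" "x \<in> lower_central G i" "y \<in> lower_central G j"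
  shows "lower_bracket G i j (lower_central G (Suc i) #> x) (lower_central G (Suc j) #> y) =
    lower_central G (Suc (i + j)) #> comm G x y"
  using L.bracket_coset[OF assms] by (simp add: bracket_lower)

end

context central_filtration
begin

lemma bracket_jacobi:
  assumes i: "0 < i" and j: "0 < j" and "X \<in> carrier (lower_factor G i)" "Y \<in> carrier (lower_factor G j)"
    "Z \<in> carrier (factor k)"
  shows "bracket (i + j) k (lower_bracket G i j X Y) Z =
    bracket i (j + k) X (bracket j k Y Z) \<otimes>\<^bsub>factor (i + j + k)\<^esub>
      inv\<^bsub>factor (i + j + k)\<^esub> bracket j (i + k) Y (bracket i k X Z)"
proof -
  from assms obtain x y z where x: "x \<in> lower_central G i" and X: "X = lower_central G (Suc i) #> x"
    and y: "y \<in> lower_central G j" and Y: "Y = lower_central G (Suc j) #> y"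
    and z: "z \<in> M k" and Z: "Z = M (Suc k) #> z" by (metis lower_factor_cosetE factor_cosetE)
  have xy: "comm G x y \<in> lower_central G (i + j)"
    using central_filtration.comm_lower_central_M[OF lower_central_filtration i x y] .
  have yz: "comm G y z \<in> M (j + k)" and xz: "comm G x z \<in> M (i + k)"
    using comm_lower_central_M i j x y z by blast+
  have xyz: "comm G x (comm G y z) \<in> M (i + j + k)" "comm G y (comm G x z) \<in> M (i + j + k)"
    using comm_lower_central_M[OF i x yz] comm_lower_central_M[OF j y xz] by (simp_all add: ac_simps)
  have "bracket i (j + k) X (bracket j k Y Z) = M (Suc (i + j + k)) #> comm G x (comm G y z)"
    unfolding X Y Z using i j x y z yz by (simp add: bracket_coset add.assoc)
  moreover have "bracket j (i + k) Y (bracket i k X Z) = M (Suc (i + j + k)) #> comm G y (comm G x z)"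
    unfolding X Y Z using i j x y z xz by (simp add: bracket_coset ac_simps)
  moreover have "bracket (i + j) k (lower_bracket G i j X Y) Z = M (Suc (i + j + k)) #> comm G (comm G x y) z"
    unfolding X Y Z using i j x y z xy by (simp add: lower_bracket_coset bracket_coset)
  ultimately show ?thesis
    using xyz M_inv by (simp add: inv_factor mult_factor jacobi_mod[OF i x j y z])
qed

end

context group
begin

interpretation L: central_filtration G "lower_central G" by (rule lower_central_filtration)

lemma comm_group_lower_factor: "comm_group (lower_factor G i)"
  using L.comm_group_factor by (simp add: factor_lower)

lemma lower_derivation_pairing:
  "graded_derivation_pairing (lower_factor G) (lower_factor G) (lower_bracket G) (lower_bracket G)"
proof -
  interpret graded_pairing "lower_factor G" "lower_factor G" "lower_bracket G"
    using comm_group_lower_factor L.bracket_biadditive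
    by (intro graded_pairing.intro graded_comm_group.intro graded_pairing_axioms.intro)
       (simp_all add: factor_lower bracket_lower)
  show ?thesis
    using L.bracket_jacobi graded_pairing_axioms
    by (intro graded_derivation_pairing.intro graded_derivation_pairing_axioms.intro)
       (simp_all add: factor_lower bracket_lower)
qed

text \<open>
  Skew-symmetry comes from \<open>[x, y]\<inverse> = [y, x]\<close>, and the Jacobi identity is the case \<open>M = \<gamma>\<close> of
  \<open>bracket_jacobi\<close>.
\<close>

lemma lower_lie_ring: "graded_lie_ring (lower_factor G) (lower_lie G)"
  unfolding lower_lie_def
proof (rule graded_lie_ring_graded_extension[OF lower_derivation_pairing])
  fix i X assume i: "0 < i" and "X \<in> carrier (lower_factor G i)"
  then obtain x where x: "x \<in> lower_central G i" and X: "X = lower_central G (Suc i) #> x"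
    by (metis L.lower_factor_cosetE)
  then show "lower_bracket G i i X X = \<one>\<^bsub>lower_factor G (i + i)\<^esub>"
    using i x L.one_factor[of "i + i"] L.M_in_carrier[OF x]
      subgroup.subset[OF normal_imp_subgroup[OF lower_central_normal]]
    by (simp add: lower_bracket_coset comm_self factor_lower)
next
  fix i j X Y assume ij: "0 < i" "0 < j"
    and "X \<in> carrier (lower_factor G i)" "Y \<in> carrier (lower_factor G j)"
  then obtain x y where x: "x \<in> lower_central G i" and X: "X = lower_central G (Suc i) #> x"
    and y: "y \<in> lower_central G j" and Y: "Y = lower_central G (Suc j) #> y"
    by (metis L.lower_factor_cosetE)
  interpret F: comm_group "L.factor (i + j)" by (rule L.comm_group_factor)
  have xy: "comm G x y \<in> lower_central G (i + j)" using L.comm_lower_central_M[OF ij(1) x y] .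
  have "lower_bracket G j i Y X = inv\<^bsub>L.factor (i + j)\<^esub> lower_bracket G i j X Y"
    using ij x y xy L.M_in_carrier[OF x] L.M_in_carrier[OF y] unfolding X Y
    by (simp add: lower_bracket_coset L.inv_factor inv_commutator add.commute)
  moreover have "lower_bracket G i j X Y \<in> carrier (L.factor (i + j))"
    using ij x y xy unfolding X Y by (simp add: lower_bracket_coset L.coset_closed)
  ultimately show "lower_bracket G i j X Y \<otimes>\<^bsub>lower_factor G (i + j)\<^esub> lower_bracket G j i Y X
      = \<one>\<^bsub>lower_factor G (i + j)\<^esub>"
    by (simp flip: factor_lower)
qed

lemma factor_upper:
  assumes "k < n"
  shows "central_filtration.factor G (\<lambda>k. upper_central G (n - k)) k = upper_factor G (n - k)"
proof -
  interpret central_filtration G "\<lambda>k. upper_central G (n - k)" by (rule upper_central_filtration)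
  show ?thesis using assms by (simp add: factor_def upper_factor_def)
qed

lemma bracket_upper:
  assumes "i + k < n"
  shows "central_filtration.bracket G (\<lambda>k. upper_central G (n - k)) i k = upper_bracket G (n - (i + k))"
proof -
  interpret central_filtration G "\<lambda>k. upper_central G (n - k)" by (rule upper_central_filtration)
  show ?thesis using assms by (simp add: fun_eq_iff bracket_def upper_bracket_def)
qed

lemma comm_group_upper_factor: "0 < i \<Longrightarrow> comm_group (upper_factor G i)"
  using central_filtration.comm_group_factor[OF upper_central_filtration, of i 0] factor_upper[of 0 i]
  by simp

lemma carrier_upper_factor: 
  "carrier (upper_factor G i) = (\<lambda>y. upper_central G (i - 1) #> y) ` upper_central G i"
  by (simp add: upper_factor_def carrier_FactGroup)

lemma comm_lower_upper:
  assumes "0 < i" "x \<in> lower_central G i" "y \<in> upper_central G (i + j)"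
  shows "comm G x y \<in> upper_central G j"
  using central_filtration.comm_lower_central_M[OF upper_central_filtration assms(1,2), of y "i + j" 0]
    assms(3) by simp

lemma upper_bracket_coset:
  assumes "0 < i" "0 < j" "x \<in> lower_central G i" "y \<in> upper_central G (i + j)"
  shows "upper_bracket G j (lower_central G (Suc i) #> x) (upper_central G (i + j - 1) #> y) =
    upper_central G (j - 1) #> comm G x y"
  using central_filtration.bracket_coset[OF upper_central_filtration assms(1,3), of y "i + j" 0]
    assms bracket_upper[of i 0 "i + j"] by simp

lemma upper_bracket_biadditive:
  assumes "0 < i" "0 < j"
  shows "biadditive (lower_factor G i) (upper_factor G (i + j)) (upper_factor G j) (upper_bracket G j)"
  using central_filtration.bracket_biadditive[OF upper_central_filtration assms(1), of "i + j" 0]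
    assms bracket_upper[of i 0 "i + j"] factor_upper[of 0 "i + j"] factor_upper[of i "i + j"] by simp

text \<open>
  With \<open>n = i + j + k\<close> the element \<open>Z\<close> has filtration degree \<open>0\<close>, and the double brackets have
  filtration degree \<open>i + j\<close>, that is, degree \<open>k\<close> in the upper central series.
\<close>

lemma upper_bracket_jacobi:
  assumes "0 < i" "0 < j" "0 < k" "X \<in> carrier (lower_factor G i)" "Y \<in> carrier (lower_factor G j)"
    "Z \<in> carrier (upper_factor G (i + j + k))"
  shows "upper_bracket G k (lower_bracket G i j X Y) Z =
    upper_bracket G k X (upper_bracket G (i + k) Y Z) \<otimes>\<^bsub>upper_factor G k\<^esub>
      inv\<^bsub>upper_factor G k\<^esub> upper_bracket G k Y (upper_bracket G (j + k) X Z)"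
  using central_filtration.bracket_jacobi[OF upper_central_filtration assms(1,2,4,5), of Z "i + j + k" 0]
    assms bracket_upper[of i 0 "i + j + k"] bracket_upper[of j 0 "i + j + k"]
    bracket_upper[of i j "i + j + k"] bracket_upper[of j i "i + j + k"]
    bracket_upper[of "i + j" 0 "i + j + k"] factor_upper[of 0 "i + j + k"]
    factor_upper[of "i + j" "i + j + k"] by (simp add: add.commute)

end

section \<open>Rationals modulo integers\<close>

abbreviation rat_add :: "rat monoid" where
  "rat_add \<equiv> \<lparr>carrier = UNIV, mult = (+), one = 0\<rparr>"

lemma comm_group_rat_add: "comm_group rat_add"
proof (rule comm_groupI)
  fix x assume "x \<in> carrier rat_add"
  show "\<exists>y\<in>carrier rat_add. y \<otimes>\<^bsub>rat_add\<^esub> x = \<one>\<^bsub>rat_add\<^esub>" by (rule bexI[of _ "- x"]) auto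
qed auto

interpretation R: comm_group rat_add by (rule comm_group_rat_add)

lemma inv_rat_add: "inv\<^bsub>rat_add\<^esub> x = - x"
  by (rule R.inv_equality) auto

lemma nat_pow_rat_add: "x [^]\<^bsub>rat_add\<^esub> n = of_nat n * x"
  by (induction n) (auto simp: algebra_simps)

lemma int_pow_rat_add: "x [^]\<^bsub>rat_add\<^esub> k = of_int k * x"
  by (cases k rule: int_cases2) (auto simp: int_pow_int R.int_pow_neg nat_pow_rat_add inv_rat_add)

lemma subgroup_Ints: "subgroup \<int> rat_add"
  by unfold_locales (auto simp: inv_rat_add)

lemma normal_Ints: "\<int> \<lhd> rat_add"
  by (rule R.subgroup_imp_normal[OF subgroup_Ints])

lemma comm_group_rat_mod_int: "comm_group rat_mod_int"
  unfolding rat_mod_int_def by (rule R.abelian_FactGroup[OF subgroup_Ints])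

interpretation Q: comm_group rat_mod_int by (rule comm_group_rat_mod_int)

abbreviation rat_class :: "rat \<Rightarrow> rat set" where
  "rat_class r \<equiv> \<int> #>\<^bsub>rat_add\<^esub> r"

lemma rat_class_hom: "rat_class \<in> hom rat_add rat_mod_int"
  unfolding rat_mod_int_def by (rule normal.r_coset_hom_Mod[OF normal_Ints])

lemma rat_classE:
  assumes "q \<in> carrier rat_mod_int" obtains r where "q = rat_class r"
  using assms by (auto simp: rat_mod_int_def carrier_FactGroup)

lemma rat_class_closed [simp]: "rat_class r \<in> carrier rat_mod_int"
  by (auto simp: rat_mod_int_def carrier_FactGroup)

lemma rat_class_int_pow: "rat_class r [^]\<^bsub>rat_mod_int\<^esub> (k::int) = rat_class (of_int k * r)"
  using hom_int_pow[OF rat_class_hom, of r k] Q.is_group R.is_group by (simp add: int_pow_rat_add)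

lemma rat_class_eq_one_iff: "rat_class r = \<one>\<^bsub>rat_mod_int\<^esub> \<longleftrightarrow> r \<in> \<int>"
proof -
  have "rat_class r = \<int> \<longleftrightarrow> r \<in> \<int>"
    using R.coset_join1[OF _ _ subgroup_Ints] R.coset_join2[OF _ subgroup_Ints] by auto
  then show ?thesis by (simp add: rat_mod_int_def)
qed

lemma rat_mod_int_divisible:
  assumes "q \<in> carrier rat_mod_int" "0 < n"
  obtains t where "t \<in> carrier rat_mod_int" "t [^]\<^bsub>rat_mod_int\<^esub> int n = q"
proof -
  obtain r where r: "q = rat_class r" using assms rat_classE by blast
  have "rat_class (r / of_nat n) [^]\<^bsub>rat_mod_int\<^esub> int n = q"
    unfolding rat_class_int_pow r using assms by simp
  then show ?thesis using that rat_class_closed by blast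
qed

text \<open>
  For \<open>n > 0\<close>, an element of order \<open>n\<close>; the \<open>n\<close>-torsion of the rationals modulo the integers is the cyclic group that
  it generates.
\<close>

definition rat_root :: "nat \<Rightarrow> rat set" where
  "rat_root n = rat_class (1 / of_nat n)"

lemma rat_root_closed [simp]: "rat_root n \<in> carrier rat_mod_int"
  by (simp add: rat_root_def)

lemma rat_root_int_pow_eq_one_iff:
  assumes "0 < n"
  shows "rat_root n [^]\<^bsub>rat_mod_int\<^esub> (k::int) = \<one>\<^bsub>rat_mod_int\<^esub> \<longleftrightarrow> int n dvd k"
proof -
  have "of_int k / (of_nat n :: rat) \<in> \<int> \<longleftrightarrow> int n dvd k"
  proof
    assume "of_int k / (of_nat n :: rat) \<in> \<int>"
    then obtain m where "of_int k / (of_nat n :: rat) = of_int m" by (auto elim: Ints_cases)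
    then have "of_int k = (of_int (m * int n) :: rat)" using assms by (simp add: field_simps)
    then have "k = m * int n" by (simp only: of_int_eq_iff)
    then show "int n dvd k" by simp
  next
    assume "int n dvd k"
    then show "of_int k / (of_nat n :: rat) \<in> \<int>" using assms by (auto elim!: dvdE)
  qed
  then show ?thesis by (simp add: rat_root_def rat_class_int_pow rat_class_eq_one_iff)
qed

lemma ord_rat_root: "0 < n \<Longrightarrow> Q.ord (rat_root n) = n"
  using rat_root_int_pow_eq_one_iff[of n "int _"] by (simp add: Q.ord_unique int_pow_int)

lemma rat_root_generates_torsion:
  assumes "0 < n" "q \<in> carrier rat_mod_int" "q [^]\<^bsub>rat_mod_int\<^esub> n = \<one>\<^bsub>rat_mod_int\<^esub>"
  obtains k :: int where "q = rat_root n [^]\<^bsub>rat_mod_int\<^esub> k"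
proof -
  obtain r where r: "q = rat_class r" using assms rat_classE by blast
  have "rat_class (of_nat n * r) = \<one>\<^bsub>rat_mod_int\<^esub>"
    using assms(3) rat_class_int_pow[of r "int n"] by (simp add: r int_pow_int)
  then obtain k where k: "of_nat n * r = of_int k"
    unfolding rat_class_eq_one_iff by (auto elim: Ints_cases)
  have "r = of_int k * (1 / of_nat n)" using k assms(1) by (simp add: field_simps)
  then have "q = rat_root n [^]\<^bsub>rat_mod_int\<^esub> k"
    by (simp only: r rat_root_def rat_class_int_pow)
  then show ?thesis by (rule that)
qed

section \<open>Extension of characters\<close>

text \<open>
  The hypotheses make \<open>p\<close> the order of the coset of \<open>a\<close> in the quotient by \<open>H\<close>; stating this with powers in
  \<open>G\<close> itself avoids passing to the quotient.
\<close>

lemma (in group) int_pow_mem_subgroup_iff: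
  assumes H: "subgroup H G" and a: "a \<in> carrier G" and p: "a [^] p \<in> H" "0 < (p::nat)"
    and min: "\<And>j. \<lbrakk>0 < j; j < p\<rbrakk> \<Longrightarrow> a [^] (j::nat) \<notin> H"
  shows "a [^] (k::int) \<in> H \<longleftrightarrow> int p dvd k"
proof
  assume k: "a [^] k \<in> H"
  have "a [^] (k mod int p) = a [^] k \<otimes> inv ((a [^] int p) [^] (k div int p))"
    using a by (simp add: int_pow_pow flip: int_pow_diff minus_mult_div_eq_mod)
  also have "\<dots> \<in> H"
    using H k p subgroup_int_pow_closed[OF H, of "a [^] p"] subgroup.m_inv_closed[OF H]
      subgroup.m_closed[OF H] by (simp add: int_pow_int)
  finally have "a [^] nat (k mod int p) \<in> H" using p by (simp flip: int_pow_int)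
  moreover have "nat (k mod int p) < p"
    using p by (simp add: nat_less_iff)
  ultimately have "\<not> 0 < nat (k mod int p)" using min by blast
  moreover have "0 \<le> k mod int p" using p by simp
  ultimately have "k mod int p = 0" by linarith
  then show "int p dvd k" by (simp add: dvd_eq_mod_eq_0)
next
  assume "int p dvd k"
  then obtain c where "k = int p * c" by (elim dvdE)
  then have "a [^] k = (a [^] p) [^] c" using a by (simp add: int_pow_pow flip: int_pow_int)
  then show "a [^] k \<in> H" using p subgroup_int_pow_closed[OF H] by simp
qed

text \<open>
  If \<open>p\<close> is the order of \<open>a\<close> modulo \<open>H\<close>, then by divisibility there is \<open>t\<close> with \<open>p\<close>-th power \<open>f (a [^] p)\<close>, and
  \<open>h \<otimes> a [^] k\<close> can be sent to the product of \<open>f h\<close> with the \<open>k\<close>-th power of \<open>t\<close>: an ambiguity in \<open>h\<close> and \<open>k\<close> is a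
  power of \<open>a\<close> in \<open>H\<close>, hence a power of \<open>a [^] p\<close>, on which \<open>f\<close> and \<open>t\<close> agree.
\<close>

lemma (in comm_group) character_extension_step:
  assumes H: "subgroup H G" and a: "a \<in> carrier G" and fin: "finite (carrier G)"
    and f: "f \<in> hom (G\<lparr>carrier := H\<rparr>) rat_mod_int"
  obtains H' f' where "subgroup H' G" "H \<subseteq> H'" "a \<in> H'"
    "f' \<in> hom (G\<lparr>carrier := H'\<rparr>) rat_mod_int" "\<And>h. h \<in> H \<Longrightarrow> f' h = f h"
proof -
  interpret H: subgroup H G by fact
  interpret GH: group "G\<lparr>carrier := H\<rparr>" by (rule subgroup_imp_group[OF H])
  interpret f: group_hom "G\<lparr>carrier := H\<rparr>" rat_mod_int f
    using f by unfold_locales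
  have f_mult: "f (x \<otimes> y) = f x \<otimes>\<^bsub>rat_mod_int\<^esub> f y" if "x \<in> H" "y \<in> H" for x y
    using that f by (simp add: hom_def)
  have f_closed: "f x \<in> carrier rat_mod_int" if "x \<in> H" for x using that f by (auto simp: hom_def)
  have f_inv: "f (inv x) = inv\<^bsub>rat_mod_int\<^esub> f x" if "x \<in> H" for x
    using that f.hom_inv[of x] H by simp
  define p where "p = (LEAST p::nat. 0 < p \<and> a [^] p \<in> H)"
  have "0 < ord a \<and> a [^] ord a \<in> H" using a fin ord_ge_1 by (simp add: Suc_le_eq)
  then have p: "0 < p" "a [^] p \<in> H" unfolding p_def by (metis (mono_tags, lifting) LeastI)+
  have min: "a [^] j \<notin> H" if "0 < j" "j < p" for j
    using that not_less_Least unfolding p_def by blast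
  obtain t where t: "t \<in> carrier rat_mod_int" and tp: "t [^]\<^bsub>rat_mod_int\<^esub> int p = f (a [^] p)"
    using rat_mod_int_divisible[OF f_closed[OF p(2)] p(1)] by blast
  have f_pow: "f (a [^] k) = t [^]\<^bsub>rat_mod_int\<^esub> k" if k: "a [^] k \<in> H" for k :: int
  proof -
    have "int p dvd k" using int_pow_mem_subgroup_iff[OF H a p(2,1) min] k by blast
    then obtain c where c: "k = int p * c" by (elim dvdE)
    have "a [^] k = (a [^] p) [^] c" using a c by (simp add: int_pow_pow flip: int_pow_int)
    also have "f \<dots> = f (a [^] p) [^]\<^bsub>rat_mod_int\<^esub> c"
      using f.hom_int_pow[of "a [^] p" c] p int_pow_consistent[OF H, of "a [^] p" c] by simp
    also have "\<dots> = t [^]\<^bsub>rat_mod_int\<^esub> k"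
      unfolding tp[symmetric] c using t by (rule Q.int_pow_pow)
    finally show ?thesis .
  qed
  define g where "g x = (SOME q. \<exists>h\<in>H. \<exists>k::int. x = h \<otimes> a [^] k \<and> q = f h \<otimes>\<^bsub>rat_mod_int\<^esub> t [^]\<^bsub>rat_mod_int\<^esub> k)" for x
  have unique: "f h \<otimes>\<^bsub>rat_mod_int\<^esub> t [^]\<^bsub>rat_mod_int\<^esub> k = f h' \<otimes>\<^bsub>rat_mod_int\<^esub> t [^]\<^bsub>rat_mod_int\<^esub> k'"
    if h: "h \<in> H" "h' \<in> H" and eq: "h \<otimes> a [^] k = h' \<otimes> a [^] k'" for h h' and k k' :: int
  proof -
    have "a [^] (k - k') = inv h \<otimes> h'"
    proof -
      have "inv h \<otimes> (h \<otimes> a [^] k) \<otimes> inv (a [^] k') = inv h \<otimes> (h' \<otimes> a [^] k') \<otimes> inv (a [^] k')"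
        using eq by simp
      then show ?thesis using h a by (simp add: int_pow_diff m_assoc flip: m_assoc[of "inv h" h])
    qed
    moreover from this have "a [^] (k - k') \<in> H" using h by simp
    ultimately have "t [^]\<^bsub>rat_mod_int\<^esub> (k - k') = inv\<^bsub>rat_mod_int\<^esub> f h \<otimes>\<^bsub>rat_mod_int\<^esub> f h'"
      using f_pow[of "k - k'"] h by (simp add: f_mult f_inv)
    then have "f h \<otimes>\<^bsub>rat_mod_int\<^esub> (t [^]\<^bsub>rat_mod_int\<^esub> (k - k') \<otimes>\<^bsub>rat_mod_int\<^esub> t [^]\<^bsub>rat_mod_int\<^esub> k')
        = f h \<otimes>\<^bsub>rat_mod_int\<^esub> (inv\<^bsub>rat_mod_int\<^esub> f h \<otimes>\<^bsub>rat_mod_int\<^esub> f h' \<otimes>\<^bsub>rat_mod_int\<^esub> t [^]\<^bsub>rat_mod_int\<^esub> k')"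
      by simp
    then show ?thesis
      using h t f_closed by (simp add: Q.int_pow_mult[symmetric] Q.m_assoc[symmetric])
  qed
  have g: "g (h \<otimes> a [^] k) = f h \<otimes>\<^bsub>rat_mod_int\<^esub> t [^]\<^bsub>rat_mod_int\<^esub> k" if "h \<in> H" for h and k :: int
    unfolding g_def by (rule some_equality) (use that unique in blast)+
  define H' where "H' = {h \<otimes> a [^] k |h k. h \<in> H \<and> (k::int) \<in> UNIV}"
  have H'I: "h \<otimes> a [^] k \<in> H'" if "h \<in> H" for h and k :: int using that by (auto simp: H'_def)
  have mult: "(h \<otimes> a [^] k) \<otimes> (h' \<otimes> a [^] k') = (h \<otimes> h') \<otimes> a [^] (k + k')"
    if "h \<in> H" "h' \<in> H" for h h' and k k' :: int
    using that a by (simp add: int_pow_mult m_ac)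
  show ?thesis
  proof (rule that)
    show "subgroup H' G"
    proof (rule subgroupI)
      show "H' \<subseteq> carrier G" using a by (auto simp: H'_def)
      show "H' \<noteq> {}" using H'I[OF H.one_closed, of 0] by blast
      show "inv x \<in> H'" if "x \<in> H'" for x
      proof -
        from that obtain h and k :: int where hk: "h \<in> H" "x = h \<otimes> a [^] k" by (auto simp: H'_def)
        then have "inv x = inv h \<otimes> a [^] (- k)" using a by (simp add: inv_mult int_pow_neg)
        then show ?thesis using hk H'I by simp
      qed
      show "x \<otimes> y \<in> H'" if "x \<in> H'" "y \<in> H'" for x y
      proof -
        from that obtain h h' and k k' :: int
          where hk: "h \<in> H" "x = h \<otimes> a [^] k" "h' \<in> H" "y = h' \<otimes> a [^] k'" by (auto simp: H'_def)
        then show ?thesis using H'I[of "h \<otimes> h'" "k + k'"] mult by simp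
      qed
    qed
    show "H \<subseteq> H'" using H'I[of _ 0] H.subset by auto
    show "a \<in> H'" using H'I[of \<one> 1] a by simp
    show "g \<in> hom (G\<lparr>carrier := H'\<rparr>) rat_mod_int"
    proof (rule homI)
      fix x assume "x \<in> carrier (G\<lparr>carrier := H'\<rparr>)"
      then show "g x \<in> carrier rat_mod_int" using t f_closed g by (auto simp: H'_def)
    next
      fix x y assume "x \<in> carrier (G\<lparr>carrier := H'\<rparr>)" "y \<in> carrier (G\<lparr>carrier := H'\<rparr>)"
      then obtain h h' and k k' :: int where hk: "h \<in> H" "x = h \<otimes> a [^] k" "h' \<in> H" "y = h' \<otimes> a [^] k'"
        by (auto simp: H'_def)
      then have "g (x \<otimes> y) = f (h \<otimes> h') \<otimes>\<^bsub>rat_mod_int\<^esub> t [^]\<^bsub>rat_mod_int\<^esub> (k + k')"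
        using mult g by simp
      then show "g (x \<otimes>\<^bsub>G\<lparr>carrier := H'\<rparr>\<^esub> y) = g x \<otimes>\<^bsub>rat_mod_int\<^esub> g y"
        using hk t f_closed by (simp add: g f_mult Q.int_pow_mult Q.m_ac)
    qed
    show "g h = f h" if "h \<in> H" for h using g[OF that, of 0] that f_closed by simp
  qed
qed

lemma (in comm_group) character_extension:
  assumes fin: "finite (carrier G)"
    and "subgroup H G" "f \<in> hom (G\<lparr>carrier := H\<rparr>) rat_mod_int"
  shows "\<exists>f'. f' \<in> hom G rat_mod_int \<and> (\<forall>h\<in>H. f' h = f h)"
  using assms(2,3)
proof (induction "card (carrier G) - card H" arbitrary: H f rule: less_induct)
  case less
  show ?case
  proof (cases "H = carrier G")
    case True
    then show ?thesis using less.prems by auto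
  next
    case False
    then obtain a where a: "a \<in> carrier G" "a \<notin> H" using subgroup.subset[OF less.prems(1)] by blast
    from character_extension_step[OF less.prems(1) a(1) fin less.prems(2)] obtain H' f' where
      H': "subgroup H' G" "H \<subseteq> H'" "a \<in> H'"
      and f': "f' \<in> hom (G\<lparr>carrier := H'\<rparr>) rat_mod_int" "\<And>h. h \<in> H \<Longrightarrow> f' h = f h" by blast
    have sub: "H' \<subseteq> carrier G" by (rule subgroup.subset[OF H'(1)])
    then have "card H < card H'" "card H' \<le> card (carrier G)"
      using H' a fin by (auto intro!: psubset_card_mono card_mono intro: finite_subset)
    then have "card (carrier G) - card H' < card (carrier G) - card H" by simp
    from less.hyps[OF this H'(1) f'(1)] show ?thesis using H'(2) f'(2) by (metis subsetD)
  qed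
qed

text \<open>
  This character is faithful on the cyclic subgroup generated by \<open>g\<close>, since \<open>rat_root (ord g)\<close> has the
  same order as \<open>g\<close>.
\<close>

lemma (in comm_group) faithful_character:
  assumes fin: "finite (carrier G)" and g: "g \<in> carrier G"
  shows "\<exists>\<chi>. \<chi> \<in> hom G rat_mod_int \<and> \<chi> g = rat_root (ord g)"
proof -
  define N where "N = ord g"
  have N: "0 < N" using ord_ge_1[OF fin g] by (simp add: N_def)
  define f where "f x = rat_root N [^]\<^bsub>rat_mod_int\<^esub> (SOME k::int. x = g [^] k)" for x
  have f: "f (g [^] k) = rat_root N [^]\<^bsub>rat_mod_int\<^esub> k" for k :: int
  proof -
    define k' where "k' = (SOME k'::int. g [^] k = g [^] k')"
    have "g [^] k = g [^] k'" unfolding k'_def by (rule someI[of _ k]) simp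
    then have "rat_root N [^]\<^bsub>rat_mod_int\<^esub> k = rat_root N [^]\<^bsub>rat_mod_int\<^esub> k'"
      using g N by (simp add: int_pow_eq Q.int_pow_eq ord_rat_root N_def)
    then show ?thesis by (simp add: f_def k'_def)
  qed
  have "f \<in> hom (G\<lparr>carrier := range (\<lambda>k::int. g [^] k)\<rparr>) rat_mod_int"
    using g by (auto simp: hom_def f Q.int_pow_mult simp flip: int_pow_mult)
  then obtain \<chi> where \<chi>: "\<chi> \<in> hom G rat_mod_int" "\<And>k::int. \<chi> (g [^] k) = f (g [^] k)"
    using character_extension[OF fin subgroup_of_powers[OF g]] by blast
  have "\<chi> g = rat_root N" using \<chi>(2)[of 1] f[of 1] g by simp
  then show ?thesis using \<chi>(1) by (auto simp: N_def)
qed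


section \<open>Dual groups\<close>

lemma dual_group_simps [simp]:
  "carrier (dual_group A) = hom A rat_mod_int \<inter> extensional (carrier A)"
  "f \<otimes>\<^bsub>dual_group A\<^esub> g = (\<lambda>a\<in>carrier A. f a \<otimes>\<^bsub>rat_mod_int\<^esub> g a)"
  "\<one>\<^bsub>dual_group A\<^esub> = (\<lambda>a\<in>carrier A. \<one>\<^bsub>rat_mod_int\<^esub>)"
  by (simp_all add: dual_group_def)

lemma (in group) comm_group_dual_group: "comm_group (dual_group G)"
proof (rule comm_groupI)
  fix f assume f: "f \<in> carrier (dual_group G)"
  then have "(\<lambda>a\<in>carrier G. inv\<^bsub>rat_mod_int\<^esub> f a) \<in> carrier (dual_group G)"
    by (auto simp: hom_def Pi_def Q.inv_mult)
  moreover have "(\<lambda>a\<in>carrier G. inv\<^bsub>rat_mod_int\<^esub> f a) \<otimes>\<^bsub>dual_group G\<^esub> f = \<one>\<^bsub>dual_group G\<^esub>"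
    using f by (auto simp: hom_def Pi_def simp del: group.inv_eq_1_iff cong: restrict_cong)
  ultimately show "\<exists>g\<in>carrier (dual_group G). g \<otimes>\<^bsub>dual_group G\<^esub> f = \<one>\<^bsub>dual_group G\<^esub>" by blast
qed (auto simp: hom_def Pi_def Q.m_ac extensional_def fun_eq_iff)

lemma (in group) inv_dual_group:
  assumes f: "f \<in> carrier (dual_group G)"
  shows "inv\<^bsub>dual_group G\<^esub> f = (\<lambda>a\<in>carrier G. inv\<^bsub>rat_mod_int\<^esub> f a)"
proof -
  interpret D: comm_group "dual_group G" by (rule comm_group_dual_group)
  show ?thesis
    using f by (intro D.inv_equality) (auto simp: hom_def Pi_def Q.inv_mult fun_eq_iff)
qed

text \<open>
  Take \<open>\<chi>\<close> with an image of largest possible size \<open>n\<close>. The image is killed by \<open>n\<close>, and it has as many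
  elements as the whole \<open>n\<close>-torsion, so it contains \<open>rat_root n\<close>; let \<open>g\<close> be a preimage.
  By \<open>faithful_character\<close>, an element of order larger than \<open>n\<close> would yield a larger image, so \<open>g\<close> has order exactly \<open>n\<close>. Hence \<open>\<chi>\<close> maps the cyclic
  group generated by \<open>g\<close> isomorphically onto its image, and this cyclic group is a direct factor with
  complement the kernel of \<open>\<chi>\<close>.
\<close>

lemma (in comm_group) maximal_character:
  assumes fin: "finite (carrier G)"
  obtains g \<chi> n where "g \<in> carrier G" "\<chi> \<in> hom G rat_mod_int" "0 < n"
    "\<chi> g = rat_root n" "g [^] n = \<one>" "\<forall>a\<in>carrier G. \<chi> a [^]\<^bsub>rat_mod_int\<^esub> n = \<one>\<^bsub>rat_mod_int\<^esub>"
    "\<forall>a\<in>carrier G. ord a \<le> n"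
proof -
  have bounded: "card (\<chi> ` carrier G) < Suc (card (carrier G))" for \<chi> :: "'a \<Rightarrow> rat set"
    using fin by (simp add: card_image_le less_Suc_eq_le)
  have "(\<lambda>_. \<one>\<^bsub>rat_mod_int\<^esub>) \<in> hom G rat_mod_int" by (simp add: hom_def)
  from ex_has_greatest_nat[of "\<lambda>\<chi>. \<chi> \<in> hom G rat_mod_int", OF this, of "\<lambda>\<chi>. card (\<chi> ` carrier G)" "Suc (card (carrier G))"]
  obtain \<chi> where \<chi>: "\<chi> \<in> hom G rat_mod_int"
    and max: "\<And>\<chi>'. \<chi>' \<in> hom G rat_mod_int \<Longrightarrow> card (\<chi>' ` carrier G) \<le> card (\<chi> ` carrier G)"
    using bounded by blast
  interpret \<chi>: group_hom G rat_mod_int \<chi> using \<chi> by unfold_locales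
  define n where "n = card (\<chi> ` carrier G)"
  have n: "0 < n" using fin by (auto simp: n_def card_gt_0_iff)
  have image: "subgroup (\<chi> ` carrier G) rat_mod_int" by (rule \<chi>.img_is_subgroup)
  interpret I: group "rat_mod_int\<lparr>carrier := \<chi> ` carrier G\<rparr>" by (rule Q.subgroup_imp_group[OF image])
  have torsion: "\<chi> a [^]\<^bsub>rat_mod_int\<^esub> n = \<one>\<^bsub>rat_mod_int\<^esub>" if "a \<in> carrier G" for a
    using I.pow_order_eq_1[of "\<chi> a"] that by (simp add: order_def n_def flip: Q.nat_pow_consistent)
  have ord_le: "ord a \<le> n" if a: "a \<in> carrier G" for a
  proof -
    let ?z = "rat_root (ord a)"
    have pos: "0 < ord a" using ord_ge_1[OF fin a] by simp
    obtain \<chi>' where \<chi>': "\<chi>' \<in> hom G rat_mod_int" "\<chi>' a = ?z" using faithful_character[OF fin a] by blast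
    have "(\<lambda>k. ?z [^]\<^bsub>rat_mod_int\<^esub> k) ` {..<ord a} \<subseteq> \<chi>' ` carrier G"
      using hom_nat_pow[OF \<chi>'(1) a] \<chi>'(2) a is_group Q.is_group by (auto intro!: image_eqI)
    moreover have "inj_on (\<lambda>k. ?z [^]\<^bsub>rat_mod_int\<^esub> k) {..<ord a}"
      using Q.ord_inj[of ?z] ord_rat_root[OF pos] pos
      by (auto simp: inj_on_def atLeast0AtMost)
    ultimately have "ord a \<le> card (\<chi>' ` carrier G)"
      using fin card_mono[of "\<chi>' ` carrier G" "(\<lambda>k. ?z [^]\<^bsub>rat_mod_int\<^esub> k) ` {..<ord a}"]
      by (simp add: card_image)
    also have "\<dots> \<le> n" using max[OF \<chi>'(1)] by (simp add: n_def)
    finally show ?thesis .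
  qed
  have "\<chi> ` carrier G \<subseteq> (\<lambda>k. rat_root n [^]\<^bsub>rat_mod_int\<^esub> k) ` {0..<int n}"
  proof
    fix q assume q: "q \<in> \<chi> ` carrier G"
    then obtain k :: int where k: "q = rat_root n [^]\<^bsub>rat_mod_int\<^esub> k"
      using rat_root_generates_torsion[OF n] torsion by (metis \<chi>.hom_closed imageE)
    have "rat_root n [^]\<^bsub>rat_mod_int\<^esub> k = rat_root n [^]\<^bsub>rat_mod_int\<^esub> (k mod int n)"
      using n by (simp add: Q.int_pow_eq ord_rat_root mod_eq_dvd_iff[symmetric])
    then show "q \<in> (\<lambda>k. rat_root n [^]\<^bsub>rat_mod_int\<^esub> k) ` {0..<int n}" using k n by auto
  qed
  moreover have "card ((\<lambda>k. rat_root n [^]\<^bsub>rat_mod_int\<^esub> k) ` {0..<int n}) \<le> card (\<chi> ` carrier G)"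
    using card_image_le[of "{0..<int n}"] by (simp add: n_def)
  ultimately have "\<chi> ` carrier G = (\<lambda>k. rat_root n [^]\<^bsub>rat_mod_int\<^esub> k) ` {0..<int n}"
    by (intro card_seteq) auto
  moreover have "rat_root n \<in> (\<lambda>k. rat_root n [^]\<^bsub>rat_mod_int\<^esub> k) ` {0..<int n}"
  proof (cases "n = 1")
    case True
    then have "rat_root n = rat_root n [^]\<^bsub>rat_mod_int\<^esub> (0::int)"
      using rat_root_int_pow_eq_one_iff[OF n, of 1] by simp
    then show ?thesis using n by (intro image_eqI[of _ _ 0]) auto
  next
    case False
    then show ?thesis using n by (intro image_eqI[of _ _ 1]) auto
  qed
  ultimately obtain g where g: "g \<in> carrier G" "\<chi> g = rat_root n" by (metis imageE)
  have "\<chi> g [^]\<^bsub>rat_mod_int\<^esub> ord g = \<one>\<^bsub>rat_mod_int\<^esub>" using g \<chi>.hom_nat_pow[of g "ord g"] by simp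
  then have "n dvd ord g" using g n by (simp add: Q.pow_eq_id ord_rat_root)
  then have "ord g = n"
    using ord_le[OF g(1)] ord_ge_1[OF fin g(1)] by (auto dest: dvd_imp_le)
  then have "g [^] n = \<one>" using g pow_ord_eq_1 by blast
  then show ?thesis using that g \<chi> n torsion ord_le by blast
qed

text \<open>
  By induction on the order. With \<open>g\<close>, \<open>\<chi>\<close> and \<open>n\<close> as in \<open>maximal_character\<close>, let \<open>K\<close> be the kernel of \<open>\<chi>\<close>,
  write \<open>a\<close> as the product of \<open>g [^] e a\<close> and \<open>\<pi> a \<in> K\<close>, and let \<open>\<psi>\<close> be an isomorphism of \<open>K\<close> with its dual.
  The sum of the pairing of cyclic groups \<open>(a, b) \<mapsto> e a * \<chi> b\<close> and of the pairing
  \<open>(a, b) \<mapsto> \<psi> (\<pi> a) (\<pi> b)\<close> then gives the isomorphism.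
\<close>

theorem iso_dual_group:
  assumes "comm_group G" "finite (carrier G)"
  shows "G \<cong> dual_group G"
  using assms
proof (induction "card (carrier G)" arbitrary: G rule: less_induct)
  case less
  interpret comm_group G by (rule less.prems(1))
  obtain g \<chi> n where g: "g \<in> carrier G" and \<chi>: "\<chi> \<in> hom G rat_mod_int" and n: "0 < n"
    and \<chi>g: "\<chi> g = rat_root n" and gn: "g [^]\<^bsub>G\<^esub> n = \<one>\<^bsub>G\<^esub>"
    and torsion: "\<forall>a\<in>carrier G. \<chi> a [^]\<^bsub>rat_mod_int\<^esub> n = \<one>\<^bsub>rat_mod_int\<^esub>"
    and ord_le: "\<forall>a\<in>carrier G. ord a \<le> n"
    by (rule maximal_character[OF less.prems(2)])
  note torsion = bspec[OF torsion] and ord_le = bspec[OF ord_le]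
  interpret \<chi>: group_hom G rat_mod_int \<chi> using \<chi> by unfold_locales
  interpret D: comm_group "dual_group G" by (rule comm_group_dual_group)
  show ?case
  proof (cases "n = 1")
    case True
    have triv: "carrier G = {\<one>\<^bsub>G\<^esub>}"
    proof -
      have "a = \<one>\<^bsub>G\<^esub>" if "a \<in> carrier G" for a
      proof -
        have "ord a = 1" using ord_le[OF that] ord_ge_1[OF less.prems(2) that] True by linarith
        then show ?thesis using ord_eq_1[OF that] by blast
      qed
      then show ?thesis using one_closed by blast
    qed
    have "f = (\<lambda>a\<in>carrier G. \<one>\<^bsub>rat_mod_int\<^esub>)" if "f \<in> carrier (dual_group G)" for f
    proof
      fix a show "f a = (\<lambda>a\<in>carrier G. \<one>\<^bsub>rat_mod_int\<^esub>) a"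
        using that hom_one[of f G rat_mod_int] Q.is_group is_group
        by (auto simp: triv extensional_def)
    qed
    then have "carrier (dual_group G) = {\<one>\<^bsub>dual_group G\<^esub>}" using D.one_closed by auto
    then have "(\<lambda>_. \<one>\<^bsub>dual_group G\<^esub>) \<in> iso G (dual_group G)"
      using triv D.one_closed by (auto simp: iso_def hom_def bij_betw_def simp del: dual_group_simps)
    then show ?thesis by (rule is_isoI)
  next
    case False
    define K where "K = kernel G rat_mod_int \<chi>"
    have K: "subgroup K G" unfolding K_def by (rule \<chi>.subgroup_kernel)
    have K_iff: "a \<in> K \<longleftrightarrow> a \<in> carrier G \<and> \<chi> a = \<one>\<^bsub>rat_mod_int\<^esub>" for a
      by (auto simp: K_def kernel_def)
    interpret K: subgroup K G by (rule K)
    let ?K = "G\<lparr>carrier := K\<rparr>"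
    have "comm_group ?K"
    proof (rule group.group_comm_groupI[OF subgroup_imp_group[OF K]])
      fix x y assume "x \<in> carrier ?K" "y \<in> carrier ?K"
      then show "x \<otimes>\<^bsub>?K\<^esub> y = y \<otimes>\<^bsub>?K\<^esub> x" using m_comm[of x y] by simp
    qed
    then interpret GK: comm_group ?K .
    interpret KD: comm_group "dual_group ?K" by (rule GK.comm_group_dual_group)
    have "g \<notin> K"
      using rat_root_int_pow_eq_one_iff[OF n, of 1] False by (simp add: K_iff \<chi>g)
    then have "card (carrier ?K) < card (carrier G)"
      using g K.subset less.prems(2) by (auto intro!: psubset_card_mono)
    moreover have "finite (carrier ?K)" using less.prems(2) K.subset finite_subset by simp
    ultimately have "?K \<cong> dual_group ?K" using less.hyps GK.comm_group_axioms by blast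
    then obtain \<psi> where \<psi>: "\<psi> \<in> iso ?K (dual_group ?K)" by (auto simp: is_iso_def)
    have \<psi>_closed: "\<psi> x \<in> hom ?K rat_mod_int" "\<psi> x \<in> extensional K" if "x \<in> K" for x
      using \<psi> that by (auto simp: iso_def hom_def Pi_def)
    have \<psi>_mult: "\<psi> (x \<otimes>\<^bsub>G\<^esub> y) = (\<lambda>a\<in>K. \<psi> x a \<otimes>\<^bsub>rat_mod_int\<^esub> \<psi> y a)" if "x \<in> K" "y \<in> K" for x y
      using \<psi> that by (auto simp: iso_def hom_def)
    have \<psi>_value: "\<psi> x a \<in> carrier rat_mod_int" if "x \<in> K" "a \<in> K" for x a
      using \<psi>_closed[OF that(1)] that by (auto simp: hom_def)
    have \<psi>_mult': "\<psi> x (a \<otimes>\<^bsub>G\<^esub> b) = \<psi> x a \<otimes>\<^bsub>rat_mod_int\<^esub> \<psi> x b"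
      if "x \<in> K" "a \<in> K" "b \<in> K" for x a b
      using \<psi>_closed[OF that(1)] that by (auto simp: hom_def)

    interpret \<psi>: group_hom ?K "dual_group ?K" \<psi>
      using \<psi> by unfold_locales (simp add: iso_def)
    have \<psi>_one: "\<psi> x \<one>\<^bsub>G\<^esub> = \<one>\<^bsub>rat_mod_int\<^esub>" if "x \<in> K" for x
      using hom_one[OF \<psi>_closed(1)[OF that] GK.is_group Q.is_group] by simp

    \<comment> \<open>the exponent is only determined modulo \<open>n\<close>; powers of \<open>g\<close> and of values of \<open>\<chi>\<close> do not see the ambiguity\<close>
    define e :: "_ \<Rightarrow> int" where "e a = (SOME k. \<chi> a = rat_root n [^]\<^bsub>rat_mod_int\<^esub> k)" for a
    have e: "\<chi> a = rat_root n [^]\<^bsub>rat_mod_int\<^esub> e a" if "a \<in> carrier G" for a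
      unfolding e_def using rat_root_generates_torsion[OF n _ torsion[OF that]] that
      by (metis (mono_tags, lifting) \<chi>.hom_closed someI)
    have cong_iff: "rat_root n [^]\<^bsub>rat_mod_int\<^esub> k = rat_root n [^]\<^bsub>rat_mod_int\<^esub> k' \<longleftrightarrow> int n dvd k - k'"
      for k k' :: int
      using n by (simp add: Q.int_pow_eq ord_rat_root dvd_diff_commute)
    have pow_cong: "g [^]\<^bsub>G\<^esub> k = g [^]\<^bsub>G\<^esub> k'" "a \<in> carrier G \<Longrightarrow> \<chi> a [^]\<^bsub>rat_mod_int\<^esub> k = \<chi> a [^]\<^bsub>rat_mod_int\<^esub> k'"
      if "int n dvd k - k'" for k k' :: int and a
    proof -
      have d: "int n dvd k' - k" using that by (simp add: dvd_diff_commute)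
      have "ord g dvd n" using g gn pow_eq_id by blast
      then show "g [^]\<^bsub>G\<^esub> k = g [^]\<^bsub>G\<^esub> k'" using d g by (meson dvd_trans int_dvd_int_iff int_pow_eq)
      assume a: "a \<in> carrier G"
      then have "Q.ord (\<chi> a) dvd n" using torsion Q.pow_eq_id by (meson \<chi>.hom_closed)
      then show "\<chi> a [^]\<^bsub>rat_mod_int\<^esub> k = \<chi> a [^]\<^bsub>rat_mod_int\<^esub> k'"
        using d a by (meson \<chi>.hom_closed dvd_trans int_dvd_int_iff Q.int_pow_eq)
    qed
    have e_mult: "int n dvd e (a \<otimes>\<^bsub>G\<^esub> b) - (e a + e b)" if "a \<in> carrier G" "b \<in> carrier G" for a b
    proof -
      have "rat_root n [^]\<^bsub>rat_mod_int\<^esub> e (a \<otimes>\<^bsub>G\<^esub> b) = rat_root n [^]\<^bsub>rat_mod_int\<^esub> (e a + e b)"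
        using that e[of a] e[of b] e[of "a \<otimes>\<^bsub>G\<^esub> b"] by (simp add: Q.int_pow_mult)
      then show ?thesis by (simp only: cong_iff)
    qed
    define \<pi> where "\<pi> a = a \<otimes>\<^bsub>G\<^esub> g [^]\<^bsub>G\<^esub> (- e a)" for a
    have \<chi>_pow: "\<chi> (g [^]\<^bsub>G\<^esub> k) = rat_root n [^]\<^bsub>rat_mod_int\<^esub> k" for k :: int
      using \<chi>.hom_int_pow[OF g, of k] by (simp add: \<chi>g)
    have \<pi>_closed: "\<pi> a \<in> K" if "a \<in> carrier G" for a
      using that g e[OF that] by (simp add: K_iff \<pi>_def \<chi>_pow flip: Q.int_pow_mult)
    have \<pi>_mult: "\<pi> (a \<otimes>\<^bsub>G\<^esub> b) = \<pi> a \<otimes>\<^bsub>G\<^esub> \<pi> b" if "a \<in> carrier G" "b \<in> carrier G" for a b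
    proof -
      have "int n dvd - e (a \<otimes>\<^bsub>G\<^esub> b) - (- e a + - e b)"
        using e_mult[OF that] by (simp add: dvd_diff_commute algebra_simps)
      then have "g [^]\<^bsub>G\<^esub> (- e (a \<otimes>\<^bsub>G\<^esub> b)) = g [^]\<^bsub>G\<^esub> (- e a) \<otimes>\<^bsub>G\<^esub> g [^]\<^bsub>G\<^esub> (- e b)"
        using g pow_cong(1) by (metis int_pow_mult)
      then show ?thesis using that g by (simp add: \<pi>_def m_ac)
    qed
    have decompose: "a = g [^]\<^bsub>G\<^esub> e a \<otimes>\<^bsub>G\<^esub> \<pi> a" if "a \<in> carrier G" for a
      using that g by (simp add: \<pi>_def m_ac flip: int_pow_mult)
    have components: "int n dvd e (g [^]\<^bsub>G\<^esub> c \<otimes>\<^bsub>G\<^esub> h) - c" "\<pi> (g [^]\<^bsub>G\<^esub> c \<otimes>\<^bsub>G\<^esub> h) = h"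
      if h: "h \<in> K" for c h
    proof -
      let ?a = "g [^]\<^bsub>G\<^esub> c \<otimes>\<^bsub>G\<^esub> h"
      have "rat_root n [^]\<^bsub>rat_mod_int\<^esub> e ?a = rat_root n [^]\<^bsub>rat_mod_int\<^esub> c"
        using h g e[of ?a] by (simp add: K_iff \<chi>_pow)
      then show d: "int n dvd e ?a - c" by (simp only: cong_iff)
      then have "int n dvd - e ?a - (- c)" by (simp add: dvd_diff_commute)
      from pow_cong(1)[OF this] have "\<pi> ?a = ?a \<otimes>\<^bsub>G\<^esub> g [^]\<^bsub>G\<^esub> (- c)" by (simp only: \<pi>_def)
      also have "\<dots> = h \<otimes>\<^bsub>G\<^esub> (g [^]\<^bsub>G\<^esub> c \<otimes>\<^bsub>G\<^esub> g [^]\<^bsub>G\<^esub> (- c))" using g h by (simp add: m_ac)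
      also have "\<dots> = h" using g h by (simp flip: int_pow_mult)
      finally show "\<pi> ?a = h" .
    qed

    define \<phi> where "\<phi> a = (\<lambda>b\<in>carrier G. \<chi> b [^]\<^bsub>rat_mod_int\<^esub> e a \<otimes>\<^bsub>rat_mod_int\<^esub> \<psi> (\<pi> a) (\<pi> b))" for a
    have \<phi>_hom: "\<phi> \<in> hom G (dual_group G)"
    proof (rule homI)
      fix a assume a: "a \<in> carrier G"
      show "\<phi> a \<in> carrier (dual_group G)"
        using a by (auto simp: \<phi>_def hom_def \<pi>_closed \<psi>_value \<psi>_mult' \<pi>_mult Q.int_pow_distrib
            Q.m_ac)
    next
      fix a a' assume a: "a \<in> carrier G" "a' \<in> carrier G"
      have "\<phi> (a \<otimes>\<^bsub>G\<^esub> a') b = (\<phi> a \<otimes>\<^bsub>dual_group G\<^esub> \<phi> a') b" if b: "b \<in> carrier G" for b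
        using a b pow_cong(2)[OF e_mult[OF a] b]
        by (simp add: \<phi>_def \<pi>_closed \<psi>_value \<pi>_mult \<psi>_mult Q.int_pow_mult Q.m_ac)
      then show "\<phi> (a \<otimes>\<^bsub>G\<^esub> a') = \<phi> a \<otimes>\<^bsub>dual_group G\<^esub> \<phi> a'"
        by (auto simp: \<phi>_def fun_eq_iff)
    qed
    interpret \<phi>: group_hom G "dual_group G" \<phi> using \<phi>_hom by unfold_locales
    have "\<phi> \<in> iso G (dual_group G)"
      unfolding \<phi>.iso_iff
    proof (intro conjI ballI impI subsetI)
      fix a assume a: "a \<in> carrier G" and one: "\<phi> a = \<one>\<^bsub>dual_group G\<^esub>"
      have eval: "\<chi> b [^]\<^bsub>rat_mod_int\<^esub> e a \<otimes>\<^bsub>rat_mod_int\<^esub> \<psi> (\<pi> a) (\<pi> b) = \<one>\<^bsub>rat_mod_int\<^esub>" if "b \<in> carrier G" for b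
        using fun_cong[OF one, of b] that by (simp add: \<phi>_def)
      have "int n dvd e g - 1" "\<pi> g = \<one>\<^bsub>G\<^esub>"
        using components[OF K.one_closed, of 1] g by simp_all
      then have "\<chi> g [^]\<^bsub>rat_mod_int\<^esub> e a = \<one>\<^bsub>rat_mod_int\<^esub>"
        using eval[OF g] \<psi>_one[OF \<pi>_closed[OF a]] g by simp
      \<comment> \<open>the value at \<open>g\<close> has detected the cyclic component; the values on \<open>K\<close> detect the other one\<close>
      then have aK: "a \<in> K" using a e[OF a] by (simp add: K_iff \<chi>g)
      have \<pi>_K: "\<pi> b = b" if "b \<in> K" for b using components(2)[OF that, of 0] that by simp
      have "\<psi> a b = \<one>\<^bsub>rat_mod_int\<^esub>" if b: "b \<in> K" for b
        using eval[of b] b aK \<psi>_value[OF aK b] by (simp add: \<pi>_K K_iff)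
      then have "\<psi> a = \<one>\<^bsub>dual_group ?K\<^esub>"
        using \<psi>_closed(2)[OF aK] by (auto simp: extensional_def fun_eq_iff)
      then show "a = \<one>\<^bsub>G\<^esub>" using aK \<psi> unfolding \<psi>.iso_iff by simp
    next
      fix f assume "f \<in> carrier (dual_group G)"
      then have f: "f \<in> hom G rat_mod_int" "f \<in> extensional (carrier G)" by simp_all
      interpret f: group_hom G rat_mod_int f using f(1) by unfold_locales
      have "f g [^]\<^bsub>rat_mod_int\<^esub> n = \<one>\<^bsub>rat_mod_int\<^esub>"
        using f.hom_nat_pow[OF g, of n] by (simp add: gn)
      then obtain c :: int where c: "f g = rat_root n [^]\<^bsub>rat_mod_int\<^esub> c"
        using rat_root_generates_torsion[OF n] g f.hom_closed by blast
      have "restrict f K \<in> carrier (dual_group ?K)" using f(1) by (auto simp: hom_def Pi_def)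
      then obtain h where h: "h \<in> K" "\<psi> h = restrict f K"
        using \<psi> unfolding \<psi>.iso_iff by (auto simp del: dual_group_simps)
      let ?a = "g [^]\<^bsub>G\<^esub> c \<otimes>\<^bsub>G\<^esub> h"
      have a: "?a \<in> carrier G" using g h by simp
      have "\<phi> ?a b = f b" if b: "b \<in> carrier G" for b
      proof -
        have "\<phi> ?a b = \<chi> b [^]\<^bsub>rat_mod_int\<^esub> c \<otimes>\<^bsub>rat_mod_int\<^esub> f (\<pi> b)"
          using b h \<pi>_closed[OF b] components[OF h(1), of c] pow_cong(2)[OF components(1)[OF h(1), of c] b]
          by (simp add: \<phi>_def)
        also have "\<chi> b [^]\<^bsub>rat_mod_int\<^esub> c = f (g [^]\<^bsub>G\<^esub> e b)"
          using f.hom_int_pow[OF g, of "e b"] by (simp add: e[OF b] c Q.int_pow_pow mult.commute)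
        also have "f (g [^]\<^bsub>G\<^esub> e b) \<otimes>\<^bsub>rat_mod_int\<^esub> f (\<pi> b) = f b"
          using b g \<pi>_closed[OF b] decompose[OF b] by (metis K.mem_carrier f.hom_mult int_pow_closed)
        finally show ?thesis .
      qed
      then have "\<phi> ?a = f" using f(2) by (fastforce simp: \<phi>_def extensional_def fun_eq_iff)
      then show "f \<in> \<phi> ` carrier G" using a by blast
    qed
    then show ?thesis by (rule is_isoI)
  qed
qed

section \<open>The action on the dual of the upper central series\<close>

context group
begin

lemma comm_group_upper_dual:
  assumes "0 < i"
  shows "comm_group (upper_dual G i)"
  using comm_group_upper_factor[OF assms] group.comm_group_dual_group comm_group.axioms(2) by blast

lemma dual_action_closed:
  assumes ij: "0 < i" "0 < j" and X: "X \<in> carrier (lower_factor G i)" and f: "f \<in> carrier (upper_dual G j)"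
  shows "dual_action G i j X f \<in> carrier (upper_dual G (i + j))"
proof -
  have f': "f \<in> hom (upper_factor G j) rat_mod_int" using f by simp
  note b = upper_bracket_biadditive[OF ij]
  have "dual_action G i j X f \<in> hom (upper_factor G (i + j)) rat_mod_int"
  proof (rule homI)
    fix Y assume Y: "Y \<in> carrier (upper_factor G (i + j))"
    then show "dual_action G i j X f Y \<in> carrier rat_mod_int"
      using hom_in_carrier[OF f' biadditive_closed[OF b X Y]] by (simp add: dual_action_def)
    fix Z assume Z: "Z \<in> carrier (upper_factor G (i + j))"
    have "Y \<otimes>\<^bsub>upper_factor G (i + j)\<^esub> Z \<in> carrier (upper_factor G (i + j))"
      using comm_group_upper_factor[of "i + j"] ij Y Z by (simp add: comm_groupE(1))
    then show "dual_action G i j X f (Y \<otimes>\<^bsub>upper_factor G (i + j)\<^esub> Z) =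
        dual_action G i j X f Y \<otimes>\<^bsub>rat_mod_int\<^esub> dual_action G i j X f Z"
      using Y Z hom_in_carrier[OF f' biadditive_closed[OF b X Y]] hom_in_carrier[OF f' biadditive_closed[OF b X Z]]
      by (simp add: dual_action_def biadditive_mult_right[OF b X] hom_mult[OF f'] biadditive_closed[OF b X]
          Q.inv_mult)
  qed
  then show ?thesis by (simp add: dual_action_def)
qed

lemma dual_action_biadditive:
  assumes ij: "0 < i" "0 < j"
  shows "biadditive (lower_factor G i) (upper_dual G j) (upper_dual G (i + j)) (dual_action G i j)"
  unfolding biadditive_def
proof (intro conjI ballI)
  fix X f assume X: "X \<in> carrier (lower_factor G i)" and f: "f \<in> carrier (upper_dual G j)"
  show "dual_action G i j X f \<in> carrier (upper_dual G (i + j))" using ij X f by (rule dual_action_closed)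
  note b = upper_bracket_biadditive[OF ij]
  have f': "f \<in> hom (upper_factor G j) rat_mod_int" using f by simp
  {
    fix X' assume X': "X' \<in> carrier (lower_factor G i)"
    have "dual_action G i j (X \<otimes>\<^bsub>lower_factor G i\<^esub> X') f Y =
        dual_action G i j X f Y \<otimes>\<^bsub>rat_mod_int\<^esub> dual_action G i j X' f Y"
      if Y: "Y \<in> carrier (upper_factor G (i + j))" for Y
      using X X' Y hom_in_carrier[OF f' biadditive_closed[OF b X Y]] hom_in_carrier[OF f' biadditive_closed[OF b X' Y]]
      by (simp add: dual_action_def biadditive_mult_left[OF b] hom_mult[OF f'] biadditive_closed[OF b] Q.inv_mult)
    then show "dual_action G i j (X \<otimes>\<^bsub>lower_factor G i\<^esub> X') f =
        dual_action G i j X f \<otimes>\<^bsub>upper_dual G (i + j)\<^esub> dual_action G i j X' f"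
      by (auto simp: dual_action_def fun_eq_iff)
  }
  {
    fix f' assume f': "f' \<in> carrier (upper_dual G j)"
    have "dual_action G i j X (f \<otimes>\<^bsub>upper_dual G j\<^esub> f') Y =
        dual_action G i j X f Y \<otimes>\<^bsub>rat_mod_int\<^esub> dual_action G i j X f' Y"
      if Y: "Y \<in> carrier (upper_factor G (i + j))" for Y
      using Y biadditive_closed[OF b X Y] f f' hom_in_carrier[OF _ biadditive_closed[OF b X Y], of _ rat_mod_int]
      by (simp add: dual_action_def Q.inv_mult)
    then show "dual_action G i j X (f \<otimes>\<^bsub>upper_dual G j\<^esub> f') =
        dual_action G i j X f \<otimes>\<^bsub>upper_dual G (i + j)\<^esub> dual_action G i j X f'"
      by (auto simp: dual_action_def fun_eq_iff)
  }
qed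

text \<open>
  Evaluating \<open>X \<cdot> (Y \<cdot> f)\<close> at \<open>Z\<close> brackets with \<open>X\<close> first and with \<open>Y\<close> second, so dualizing exchanges the two terms of
  \<open>upper_bracket_jacobi\<close>. The sign in the definition of the action is what restores the module identity:
  it cancels in the double actions, but remains once on the side of the bracket.
\<close>

lemma dual_derivation_pairing:
  "graded_derivation_pairing (lower_factor G) (upper_dual G) (lower_bracket G) (dual_action G)"
proof -
  interpret lower: graded_derivation_pairing "lower_factor G" "lower_factor G" "lower_bracket G" "lower_bracket G"
    by (rule lower_derivation_pairing)
  show ?thesis
  proof (intro graded_derivation_pairing.intro graded_pairing.intro graded_comm_group.intro
      graded_pairing_axioms.intro graded_derivation_pairing_axioms.intro)
    fix i j k X Y f
    assume ijk: "0 < i" "0 < j" "0 < k" and X: "X \<in> carrier (lower_factor G i)"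
      and Y: "Y \<in> carrier (lower_factor G j)" and f: "f \<in> carrier (upper_dual G k)"
    have f': "f \<in> hom (upper_factor G k) rat_mod_int" using f by simp
    interpret U: comm_group "upper_factor G k" using ijk(3) by (rule comm_group_upper_factor)
    interpret f: group_hom "upper_factor G k" rat_mod_int f using f' by unfold_locales
    interpret UD: comm_group "upper_dual G (i + j + k)" using ijk by (intro comm_group_upper_dual) simp
    interpret Un: comm_group "upper_factor G (i + j + k)" using ijk by (intro comm_group_upper_factor) simp
    have Xf: "dual_action G i k X f \<in> carrier (upper_dual G (i + k))"
      and Yf: "dual_action G j k Y f \<in> carrier (upper_dual G (j + k))"
      using ijk X Y f dual_action_closed by blast+
    have XYf: "dual_action G i (j + k) X (dual_action G j k Y f) \<in> carrier (upper_dual G (i + j + k))"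
      and YXf: "dual_action G j (i + k) Y (dual_action G i k X f) \<in> carrier (upper_dual G (i + j + k))"
      using dual_action_closed[OF _ _ X Yf] dual_action_closed[OF _ _ Y Xf] ijk by (simp_all add: ac_simps del: dual_group_simps)
    show "dual_action G (i + j) k (lower_bracket G i j X Y) f =
      dual_action G i (j + k) X (dual_action G j k Y f) \<otimes>\<^bsub>upper_dual G (i + j + k)\<^esub>
      inv\<^bsub>upper_dual G (i + j + k)\<^esub> dual_action G j (i + k) Y (dual_action G i k X f)" (is "?l = ?r")
    proof (rule extensionalityI[of _ "carrier (upper_factor G (i + j + k))"])
      fix Z assume Z: "Z \<in> carrier (upper_factor G (i + j + k))"
      have XZ: "upper_bracket G (j + k) X Z \<in> carrier (upper_factor G (j + k))"
        and YZ: "upper_bracket G (i + k) Y Z \<in> carrier (upper_factor G (i + k))"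
        using biadditive_closed[OF upper_bracket_biadditive X, of "j + k" Z]
          biadditive_closed[OF upper_bracket_biadditive Y, of "i + k" Z] ijk Z by (simp_all add: ac_simps)
      have XYZ: "upper_bracket G k X (upper_bracket G (i + k) Y Z) \<in> carrier (upper_factor G k)"
        and YXZ: "upper_bracket G k Y (upper_bracket G (j + k) X Z) \<in> carrier (upper_factor G k)"
        using biadditive_closed[OF upper_bracket_biadditive X YZ] biadditive_closed[OF upper_bracket_biadditive Y XZ]
          ijk by simp_all
      have l: "?l Z = inv\<^bsub>rat_mod_int\<^esub> f (upper_bracket G k X (upper_bracket G (i + k) Y Z))
          \<otimes>\<^bsub>rat_mod_int\<^esub> f (upper_bracket G k Y (upper_bracket G (j + k) X Z))"
        using Z XYZ YXZ by (simp add: dual_action_def upper_bracket_jacobi[OF ijk X Y Z] Q.inv_mult)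
      have "dual_action G i (j + k) X (dual_action G j k Y f) Z = f (upper_bracket G k Y (upper_bracket G (j + k) X Z))"
        using Z XZ YXZ by (simp add: dual_action_def ac_simps)
      moreover have "dual_action G j (i + k) Y (dual_action G i k X f) Z = f (upper_bracket G k X (upper_bracket G (i + k) Y Z))"
        using Z YZ XYZ by (simp add: dual_action_def ac_simps)
      ultimately have "?r Z = f (upper_bracket G k Y (upper_bracket G (j + k) X Z)) \<otimes>\<^bsub>rat_mod_int\<^esub>
          inv\<^bsub>rat_mod_int\<^esub> f (upper_bracket G k X (upper_bracket G (i + k) Y Z))"
        using Z Un.inv_dual_group[OF YXf] by simp
      then show "?l Z = ?r Z" using l XYZ YXZ by (simp add: Q.m_comm)
    qed (simp_all add: dual_action_def)
  next
    fix i j :: nat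
    assume "0 < i" "0 < j"
    then show "biadditive (lower_factor G i) (upper_dual G j) (upper_dual G (i + j)) (dual_action G i j)"
      by (rule dual_action_biadditive)
  qed (use comm_group_upper_dual lower.L.comm_group_V lower.m_biadditive in blast)+
qed

lemma dual_action_coset:
  assumes ij: "0 < i" "0 < j" and x: "x \<in> lower_central G i" and y: "y \<in> upper_central G (i + j)"
  shows "dual_action G i j (lower_central G (Suc i) #> x) f (upper_central G (i + j - 1) #> y)
    = inv\<^bsub>rat_mod_int\<^esub> (f (upper_central G (j - 1) #> comm G x y))"
  using y by (simp add: dual_action_def upper_bracket_coset[OF ij x y, simplified] carrier_upper_factor)

lemma finite_upper_factor: "finite (carrier G) \<Longrightarrow> finite (carrier (upper_factor G i))"
  unfolding carrier_upper_factor
  by (intro finite_imageI) (rule finite_subset[of _ "carrier G"], auto)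

end

theorem corollary1:
  fixes G :: "('a, 'b) monoid_scheme"
  assumes "group G" and "finite (carrier G)"
  shows
    "graded_lie_ring (lower_factor G) (lower_lie G)
     \<and> (\<forall>i>0. \<forall>j>0. \<forall>x \<in> lower_central G i. \<forall>y \<in> lower_central G j.
          lower_bracket G i j (lower_central G (i + 1) #>\<^bsub>G\<^esub> x) (lower_central G (j + 1) #>\<^bsub>G\<^esub> y)
            = lower_central G (i + j + 1) #>\<^bsub>G\<^esub> comm G x y)
     \<and> (\<forall>i>0. \<forall>j>0. \<forall>x \<in> lower_central G i. \<forall>f \<in> carrier (upper_dual G j).
          dual_action G i j (lower_central G (i + 1) #>\<^bsub>G\<^esub> x) f \<in> carrier (upper_dual G (i + j))
          \<and> (\<forall>y \<in> upper_central G (i + j).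
               comm G x y \<in> upper_central G j
               \<and> dual_action G i j (lower_central G (i + 1) #>\<^bsub>G\<^esub> x) f (upper_central G (i + j - 1) #>\<^bsub>G\<^esub> y)
                   = inv\<^bsub>rat_mod_int\<^esub> (f (upper_central G (j - 1) #>\<^bsub>G\<^esub> comm G x y))))
     \<and> graded_lie_module (lower_factor G) (lower_lie G) (upper_dual G) (dual_lie_action G)
     \<and> (\<forall>i>0. upper_factor G i \<cong> upper_dual G i)
     \<and> (\<forall>\<phi>. (\<forall>i>0. \<phi> i \<in> iso (upper_factor G i) (upper_dual G i)) \<longrightarrow>
          graded_lie_module (lower_factor G) (lower_lie G)
            (upper_factor G) (transported_lie_action G \<phi>))"
proof -
  interpret group G by fact
  have lower_coset: "lower_central G (Suc i) #>\<^bsub>G\<^esub> x \<in> carrier (lower_factor G i)"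
    if "x \<in> lower_central G i" for i x
    using that by (simp add: lower_factor_def carrier_FactGroup)
  have module: "graded_lie_module (lower_factor G) (lower_lie G) V (graded_extension V m)"
    if "graded_derivation_pairing (lower_factor G) V (lower_bracket G) m" for V :: "nat \<Rightarrow> 'v monoid" and m
    using graded_lie_module_graded_extension[OF _ that] lower_lie_ring by (simp add: lower_lie_def)
  show ?thesis
  proof (intro conjI allI ballI impI)
    show "graded_lie_ring (lower_factor G) (lower_lie G)" by (rule lower_lie_ring)
    show "graded_lie_module (lower_factor G) (lower_lie G) (upper_dual G) (dual_lie_action G)"
      unfolding dual_lie_action_def by (rule module[OF dual_derivation_pairing])
  next
    fix i j x y
    assume "0 < i" "x \<in> lower_central G i" "y \<in> lower_central G j"
    then show "lower_bracket G i j (lower_central G (i + 1) #>\<^bsub>G\<^esub> x) (lower_central G (j + 1) #>\<^bsub>G\<^esub> y)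
        = lower_central G (i + j + 1) #>\<^bsub>G\<^esub> comm G x y"
      using lower_bracket_coset by simp
  next
    fix i j x f
    assume ij: "0 < i" "0 < j" and x: "x \<in> lower_central G i" and f: "f \<in> carrier (upper_dual G j)"
    show "dual_action G i j (lower_central G (i + 1) #>\<^bsub>G\<^esub> x) f \<in> carrier (upper_dual G (i + j))"
      using dual_action_closed[OF ij lower_coset[OF x] f] by simp
    fix y assume y: "y \<in> upper_central G (i + j)"
    show "comm G x y \<in> upper_central G j" using ij(1) x y by (rule comm_lower_upper)
    show "dual_action G i j (lower_central G (i + 1) #>\<^bsub>G\<^esub> x) f (upper_central G (i + j - 1) #>\<^bsub>G\<^esub> y)
        = inv\<^bsub>rat_mod_int\<^esub> (f (upper_central G (j - 1) #>\<^bsub>G\<^esub> comm G x y))"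
      using dual_action_coset[OF ij x y] by simp
  next
    fix i :: nat assume "0 < i"
    then show "upper_factor G i \<cong> upper_dual G i"
      using finite_upper_factor[OF assms(2)] by (intro iso_dual_group comm_group_upper_factor)
  next
    fix \<phi> assume "\<forall>i>0. \<phi> i \<in> iso (upper_factor G i) (upper_dual G i)"
    then show "graded_lie_module (lower_factor G) (lower_lie G) (upper_factor G) (transported_lie_action G \<phi>)"
      using module[OF graded_derivation_pairing_transport[OF dual_derivation_pairing, of "upper_factor G" \<phi>]]
        comm_group_upper_factor by (simp add: transported_lie_action_def transported_action_def[abs_def])
  qed
qed

end
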